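(* Let $\mathbb{A}\in\mathbb{M}_d$ be partitioned into $r$ blocks $A_k\in\mathbb{M}_{n_k,m_k}$, $k=1,\ldots,r$, and assume that the partitioning is row compatible or column compatible. Let $\psi(t)$ be a (real-valued) monotone function on $[0,\infty)$ such that $t\mapsto\psi(\sqrt t)$ is convex on $[0,\infty)$ and $\psi(0)=0$. Then there exist isometries $V_k\in\mathbb{M}_{d,m_k}$, $k=1,\ldots,r$, such that $$\psi(|\mathbb{A}|)\ \ge\ \sum_{k=1}^r V_k\,\psi(|A_k|)\,V_k^*.$$
   Context: $\mathbb{M}_{n,m}$ is the space of complex $n\times m$ matrices and $\mathbb{M}_n=\mathbb{M}_{n,n}$. For $S\in\mathbb{M}_{n,m}$, $|S|=(S^*S)^{1/2}\in\mathbb{M}_m$ is its absolute value; functions of positive semidefinite matrices are defined by the spectral functional calculus. Monotone means nondecreasing or nonincreasing. A matrix $V\in\mathbb{M}_{n,m}$ with $m\le n$ is an isometry if $V^*V$ is the identity of $\mathbb{M}_m$. The relation $\ge$ between Hermitian matrices is the Loewner order. A partitioning of $\mathbb{A}$ into blocks $A_1,\dots,A_r$ is a decomposition of the array of entries of $\mathbb{A}$ into pairwise disjoint nonempty rectangular blocks (submatrices formed by consecutive rows and consecutive columns) covering all entries; each $A_k$ is regarded both as an $n_k\times m_k$ matrix and as a submatrix with its position in $\mathbb{A}$. The partitioning is column compatible if for all $k,l$ either $A_k$ and $A_l$ lie on the same set of columns of $\mathbb{A}$ or they lie on disjoint sets of columns. It is row compatible if for all $k,l$ either $A_k$ and $A_l$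 lie on the same set of rows of $\mathbb{A}$ or they lie on disjoint sets of rows. *)

theory Defs
  imports
    "HOL-Analysis.Convex"
    "HOL-Library.Disjoint_Sets"
    "Jordan_Normal_Form.Schur_Decomposition"
    "Jordan_Normal_Form.DL_Submatrix"
begin

definition isometry_mat :: "nat \<Rightarrow> nat \<Rightarrow> complex mat \<Rightarrow> bool" where
  "isometry_mat n m V \<longleftrightarrow>
     m \<le> n \<and> V \<in> carrier_mat n m \<and> mat_adjoint V * V = 1\<^sub>m m"

definition hermitian_mat :: "complex mat \<Rightarrow> bool" where
  "hermitian_mat A \<longleftrightarrow> mat_adjoint A = A"

definition loewner_le :: "complex mat \<Rightarrow> complex mat \<Rightarrow> bool" where
  "loewner_le A B \<longleftrightarrow>
     (\<exists>n. A \<in> carrier_mat n n \<and> B \<in> carrier_mat n n \<and> hermitian_mat A \<and> hermitian_mat B \<and>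
       (\<forall>x \<in> carrier_vec n. 0 \<le> Re (((B - A) *\<^sub>v x) \<bullet>c x)))"

text \<open>Spectral functional calculus: if \<open>A = U diag(\<lambda>) U\<^sup>*\<close> with \<open>U\<close> unitary and \<open>\<lambda>\<close> real, then
  \<open>f(A) = U diag(f \<circ> \<lambda>) U\<^sup>*\<close>. For Hermitian \<open>A\<close> such a diagonalisation exists and the result does not
  depend on it; the value is unspecified for other matrices.\<close>

definition mat_fun :: "(real \<Rightarrow> real) \<Rightarrow> complex mat \<Rightarrow> complex mat" where
  "mat_fun f A = (let n = dim_row A in
     THE B. \<exists>U l. isometry_mat n n U \<and>
       A = U * mat_diag n (\<lambda>i. complex_of_real (l i)) * mat_adjoint U \<and>
       B = U * mat_diag n (\<lambda>i. complex_of_real (f (l i))) * mat_adjoint U)"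

definition mat_abs :: "complex mat \<Rightarrow> complex mat" where
  "mat_abs S = mat_fun sqrt (mat_adjoint S * S)"

definition nonempty_interval :: "nat \<Rightarrow> nat set \<Rightarrow> bool" where
  "nonempty_interval d I \<longleftrightarrow> (\<exists>a b. a < b \<and> b \<le> d \<and> I = {a..<b})"

text \<open>The \<open>k\<close>-th block occupies the (0-based) row indices \<open>I k\<close> and column indices \<open>J k\<close>, so that as a
  matrix it is \<^term>\<open>submatrix A (I k) (J k)\<close>.\<close>

definition block_partition :: "nat \<Rightarrow> nat \<Rightarrow> (nat \<Rightarrow> nat set) \<Rightarrow> (nat \<Rightarrow> nat set) \<Rightarrow> bool" where
  "block_partition d r I J \<longleftrightarrow>
     (\<forall>k \<in> {1..r}. nonempty_interval d (I k) \<and> nonempty_interval d (J k)) \<and>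
     disjoint_family_on (\<lambda>k. I k \<times> J k) {1..r} \<and>
     (\<Union>k \<in> {1..r}. I k \<times> J k) = {..<d} \<times> {..<d}"

text \<open>Used with the row index sets for row compatibility, with the column index sets for column
  compatibility.\<close>

definition compatible :: "nat \<Rightarrow> (nat \<Rightarrow> nat set) \<Rightarrow> bool" where
  "compatible r I \<longleftrightarrow> (\<forall>k \<in> {1..r}. \<forall>l \<in> {1..r}. I k = I l \<or> I k \<inter> I l = {})"

end

theory Submission
  imports Defs "Jordan_Normal_Form.Spectral_Radius"
begin

text \<open>
  Put \<open>g t = \<psi> (sqrt t)\<close>, so that \<open>\<psi>(|S|) = g(S\<^sup>* S)\<close>; the function \<open>g\<close> is convex and monotone on
  \<open>[0,\<infinity>)\<close> with \<open>g 0 = 0\<close>. The core of the argument is a pinching inequality (lemma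
  \<open>pinching_superadditive\<close>): if \<open>H\<close> is positive semidefinite and the \<open>Y\<^sub>k\<close> are Hermitian with
  \<open>\<Sum> Y\<^sub>k\<^sup>2 = 1\<close>, then there are unitaries \<open>U\<^sub>k\<close> with \<open>g(H) \<ge> \<Sum> U\<^sub>k g(Y\<^sub>k H Y\<^sub>k) U\<^sub>k\<^sup>*\<close>.

  Its proof rests on two facts. First, a compression dominates up to a unitary: for a contraction
  \<open>Y\<close>, the matrix \<open>Y g(H) Y\<^sup>*\<close> has, in decreasing order, eigenvalues at least as large as those of
  \<open>g(Y H Y\<^sup>*)\<close> (lemma \<open>compression_orbit_le\<close>). This combines Jensen's inequality for the spectral
  weights of a vector with the min-max principle. Monotonicity of \<open>g\<close> enters through its superlevel
  sets, which are intervals; this treats increasing and decreasing \<open>g\<close> at the same time. Secondly,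
  \<open>B B\<^sup>*\<close> and \<open>B\<^sup>* B\<close> are unitarily equivalent for square \<open>B\<close>. Since \<open>g\<close> has a constant sign \<open>s\<close>,
  the matrix \<open>R = (s g(H))\<^bsup>1/2\<^esup>\<close> exists and \<open>s g(H) = R\<^sup>2 = \<Sum> R Y\<^sub>k Y\<^sub>k R\<close>, where each
  \<open>R Y\<^sub>k Y\<^sub>k R\<close> is unitarily equivalent to \<open>Y\<^sub>k R R Y\<^sub>k = s Y\<^sub>k g(H) Y\<^sub>k\<close>, a compression of \<open>s g(H)\<close>.

  Cutting a square matrix \<open>C\<close> into column strips \<open>C Y\<^sub>k\<close>, with \<open>Y\<^sub>k\<close> coordinate projections, pinches
  \<open>C\<^sup>* C\<close>. Cutting it into row strips pinches \<open>C C\<^sup>*\<close>, which is unitarily equivalent to \<open>C\<^sup>* C\<close>. A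
  column compatible partitioning cuts \<open>A\<close> into column strips and then each strip into row pieces; a
  row compatible one does this in the opposite order. Two applications of the pinching inequality
  therefore reach the blocks.

  Throughout, a block is kept as a \<open>d \<times> d\<close> matrix that vanishes outside its position, so that every
  equivalence is a unitary one in the same dimension. If \<open>P\<^sub>J\<close> is the coordinate isometry with range
  the columns \<open>J\<close> of the block \<open>B\<close>, the padded block has Gram matrix \<open>P\<^sub>J B\<^sup>* B P\<^sub>J\<^sup>*\<close>, and
  because \<open>g 0 = 0\<close> the functional calculus commutes with this padding. The isometries of the theorem
  are \<open>V\<^sub>k = U\<^sub>k P\<^sub>J\<close> with \<open>U\<^sub>k\<close> the accumulated unitaries. Inequalities between sums of matrices are
  expressed by quadratic forms until the last step.
\<close>

section \<open>Adjoints, quadratic forms and isometries\<close>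

abbreviation adj :: "complex mat \<Rightarrow> complex mat" where
  "adj \<equiv> mat_adjoint"

abbreviation real_diag :: "nat \<Rightarrow> (nat \<Rightarrow> real) \<Rightarrow> complex mat" where
  "real_diag n l \<equiv> mat_diag n (\<lambda>i. complex_of_real (l i))"

abbreviation unitary_mat :: "nat \<Rightarrow> complex mat \<Rightarrow> bool" where
  "unitary_mat n U \<equiv> isometry_mat n n U"

lemma dim_adj [simp]: "dim_row (adj A) = dim_col A" "dim_col (adj A) = dim_row A"
  by (auto simp: mat_adjoint_def mat_of_rows_def)

lemma adj_carrier [simp]: "dim_row A = n \<Longrightarrow> dim_col A = m \<Longrightarrow> adj A \<in> carrier_mat m n"
  by (rule carrier_matI) auto

text \<open>Stated by dimensions instead of carrier sets, the rules below have side conditions in which no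
  inner dimension has to be guessed, so that simplification can decide them.\<close>
lemma mult_carrier_dim [simp]: "dim_row A = n \<Longrightarrow> dim_col B = m \<Longrightarrow> A * B \<in> carrier_mat n m"
  by (rule carrier_matI) auto

lemma mult_vec_carrier_dim [simp]: "dim_row A = n \<Longrightarrow> A *\<^sub>v x \<in> carrier_vec n"
  by (rule carrier_vecI) auto

lemma dim_mat_diag [simp]: "dim_row (mat_diag n f) = n" "dim_col (mat_diag n f) = n"
  by (auto simp: mat_diag_def)

lemma mat_assoc: "dim_col A = dim_row B \<Longrightarrow> dim_col B = dim_row C \<Longrightarrow> (A * B) * C = A * (B * C)"
  by (rule assoc_mult_mat) auto

lemma mat_vec_assoc: "dim_col A = dim_row B \<Longrightarrow> dim_col B = dim_vec x \<Longrightarrow> (A * B) *\<^sub>v x = A *\<^sub>v (B *\<^sub>v x)"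
  by (rule assoc_mult_mat_vec) auto

lemma adj_index [simp]: "i < dim_col A \<Longrightarrow> j < dim_row A \<Longrightarrow> adj A $$ (i, j) = cnj (A $$ (j, i))"
  by (auto simp: mat_adjoint_def mat_of_rows_def)

lemma adj_adj [simp]: "adj (adj A) = A"
  by (rule eq_matI) auto

lemma adj_mult:
  assumes "dim_col A = dim_row B"
  shows "adj (A * B) = adj B * adj A"
  using assms by (intro eq_matI) (auto simp: scalar_prod_def mult.commute intro!: sum.cong)

lemma adj_one [simp]: "adj (1\<^sub>m n) = 1\<^sub>m n"
  by (rule eq_matI) auto

lemma adj_real_diag [simp]: "adj (real_diag n l) = real_diag n l"
  by (rule eq_matI) (auto simp: mat_diag_def)

lemma inner_sum:
  "x \<in> carrier_vec n \<Longrightarrow> y \<in> carrier_vec n \<Longrightarrow> x \<bullet>c y = (\<Sum>i<n. x $ i * cnj (y $ i))"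
  by (auto simp: scalar_prod_def atLeast0LessThan)

lemma mult_mat_vec_sum:
  "A \<in> carrier_mat n m \<Longrightarrow> x \<in> carrier_vec m \<Longrightarrow> i < n \<Longrightarrow> (A *\<^sub>v x) $ i = (\<Sum>j<m. A $$ (i, j) * x $ j)"
  by (auto simp: scalar_prod_def atLeast0LessThan)

lemma adj_inner:
  assumes A: "A \<in> carrier_mat n m" and x: "x \<in> carrier_vec m" and y: "y \<in> carrier_vec n"
  shows "(A *\<^sub>v x) \<bullet>c y = x \<bullet>c (adj A *\<^sub>v y)"
proof -
  have "(A *\<^sub>v x) \<bullet>c y = (\<Sum>i<n. \<Sum>j<m. A $$ (i, j) * x $ j * cnj (y $ i))"
    using assms by (subst inner_sum[of _ n]) (auto simp: mult_mat_vec_sum[of _ n m] sum_distrib_right simp del: index_mult_mat_vec)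
  also have "\<dots> = (\<Sum>j<m. \<Sum>i<n. A $$ (i, j) * x $ j * cnj (y $ i))"
    by (rule sum.swap)
  also have "\<dots> = x \<bullet>c (adj A *\<^sub>v y)"
    using assms by (subst inner_sum[of _ m])
      (auto simp: mult_mat_vec_sum[of _ m n] sum_distrib_left mult_ac simp del: index_mult_mat_vec intro!: sum.cong)
  finally show ?thesis .
qed

lemma adj_mult_vec_index:
  assumes "A \<in> carrier_mat n m" "x \<in> carrier_vec n" "j < m"
  shows "(adj A *\<^sub>v x) $ j = x \<bullet>c col A j"
  using assms
  by (subst mult_mat_vec_sum[of _ m n], simp_all del: index_mult_mat_vec, subst inner_sum[of _ n])
    (auto simp: mult.commute intro!: sum.cong)

definition nsq :: "complex vec \<Rightarrow> real" where
  "nsq x = Re (x \<bullet>c x)"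

definition qf :: "complex mat \<Rightarrow> complex vec \<Rightarrow> real" where
  "qf A x = Re ((A *\<^sub>v x) \<bullet>c x)"

lemma nsq_sum: "x \<in> carrier_vec n \<Longrightarrow> nsq x = (\<Sum>i<n. (cmod (x $ i))\<^sup>2)"
  unfolding nsq_def by (subst inner_sum[of x n]) (auto simp: complex_mult_cnj cmod_power2)

lemma inner_self: "x \<in> carrier_vec n \<Longrightarrow> x \<bullet>c x = complex_of_real (nsq x)"
  unfolding nsq_sum[of x n] by (subst inner_sum[of x n]) (auto simp: complex_norm_square simp del: of_real_power)

lemma nsq_nonneg: "x \<in> carrier_vec n \<Longrightarrow> 0 \<le> nsq x"
  by (simp add: nsq_sum[of x n] sum_nonneg)

lemma nsq_pos: "x \<in> carrier_vec n \<Longrightarrow> x \<noteq> 0\<^sub>v n \<Longrightarrow> 0 < nsq x"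
  by (metis inner_self nsq_nonneg conjugate_square_eq_0_vec of_real_0 order_le_less)

lemma qf_conj:
  assumes "A \<in> carrier_mat m m" "B \<in> carrier_mat n m" "x \<in> carrier_vec n"
  shows "qf (B * A * adj B) x = qf A (adj B *\<^sub>v x)"
proof -
  have "(B * A * adj B) *\<^sub>v x = B *\<^sub>v (A *\<^sub>v (adj B *\<^sub>v x))"
    using assms by (simp add: mat_vec_assoc)
  then show ?thesis
    using assms unfolding qf_def by (simp add: adj_inner[of B n m])
qed

lemma nsq_mult:
  assumes "B \<in> carrier_mat n m" "x \<in> carrier_vec m"
  shows "nsq (B *\<^sub>v x) = qf (adj B * B) x"
proof -
  have "(adj B *\<^sub>v (B *\<^sub>v x)) \<bullet>c x = (B *\<^sub>v x) \<bullet>c (B *\<^sub>v x)"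
    using assms by (subst adj_inner[of _ m n]) auto
  then show ?thesis
    using assms unfolding qf_def nsq_def by (simp add: mat_vec_assoc)
qed

lemma real_diag_mult_vec:
  assumes "x \<in> carrier_vec n" "i < n"
  shows "(real_diag n l *\<^sub>v x) $ i = l i * x $ i"
proof -
  have "(real_diag n l *\<^sub>v x) $ i = (\<Sum>j<n. real_diag n l $$ (i, j) * x $ j)"
    using assms by (subst mult_mat_vec_sum[of _ n n]) auto
  also have "\<dots> = (\<Sum>j<n. if i = j then l j * x $ j else 0)"
    using assms by (intro sum.cong) (auto simp: mat_diag_def)
  finally show ?thesis using assms by simp
qed

lemma qf_real_diag:
  assumes "x \<in> carrier_vec n"
  shows "qf (real_diag n l) x = (\<Sum>i<n. l i * (cmod (x $ i))\<^sup>2)"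
proof -
  have "(real_diag n l *\<^sub>v x) \<bullet>c x = (\<Sum>i<n. complex_of_real (l i * (cmod (x $ i))\<^sup>2))"
    using assms by (subst inner_sum[of _ n])
      (auto simp: real_diag_mult_vec complex_norm_square mult_ac simp del: index_mult_mat_vec of_real_power intro!: sum.cong)
  then show ?thesis unfolding qf_def by simp
qed

lemma qf_spectral:
  assumes "U \<in> carrier_mat n m" "x \<in> carrier_vec n"
  shows "qf (U * real_diag m l * adj U) x = (\<Sum>i<m. l i * (cmod ((adj U *\<^sub>v x) $ i))\<^sup>2)"
  using assms by (subst qf_conj[of _ m _ n], simp_all del: index_mult_mat_vec, subst qf_real_diag) auto

lemma isometryD:
  assumes "isometry_mat n m V"
  shows "V \<in> carrier_mat n m" "adj V * V = 1\<^sub>m m" "m \<le> n"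
  using assms by (auto simp: isometry_mat_def)

lemma unitaryD:
  assumes "unitary_mat n U"
  shows "U \<in> carrier_mat n n" "adj U * U = 1\<^sub>m n" "U * adj U = 1\<^sub>m n"
proof -
  note U = isometryD[OF assms]
  show "U \<in> carrier_mat n n" "adj U * U = 1\<^sub>m n" by (fact U)+
  show "U * adj U = 1\<^sub>m n"
    by (rule mat_mult_left_right_inverse[OF _ U(1) U(2)]) (use U(1) in simp)
qed

lemma unitary_adj: "unitary_mat n U \<Longrightarrow> unitary_mat n (adj U)"
  using unitaryD[of n U] unfolding isometry_mat_def by auto

lemma isometry_mult:
  assumes "isometry_mat n k V" "isometry_mat k m W"
  shows "isometry_mat n m (V * W)"
proof -
  note V = isometryD[OF assms(1)] and W = isometryD[OF assms(2)]
  have "adj (V * W) * (V * W) = adj W * (adj V * V * W)"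
    using V(1) W(1) by (simp add: adj_mult mat_assoc)
  also have "\<dots> = 1\<^sub>m m" using V W by simp
  finally show ?thesis using V W by (auto simp: isometry_mat_def)
qed

lemma nsq_isometry: "isometry_mat n m V \<Longrightarrow> x \<in> carrier_vec m \<Longrightarrow> nsq (V *\<^sub>v x) = nsq x"
  using isometryD[of n m V] by (subst nsq_mult[of V n m]) (auto simp: qf_def nsq_def)

section \<open>The spectral theorem for Hermitian matrices\<close>

text \<open>Fewer than \<open>n\<close> linear conditions on an \<open>n\<close>-dimensional vector have a nonzero solution: written
  as a square system padded with zero rows, they have determinant zero. This dimension count serves
  both the completion of orthonormal families and the min-max principle.\<close>
lemma exists_orthogonal:
  assumes k: "k < n" and f: "\<And>i. i < k \<Longrightarrow> f i \<in> carrier_vec n"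
  shows "\<exists>v. v \<in> carrier_vec n \<and> v \<noteq> 0\<^sub>v n \<and> (\<forall>i<k. v \<bullet>c (f i :: complex vec) = 0)"
proof -
  define c where "c = (\<lambda>i. if i < k then conjugate (f i) else 0\<^sub>v n)"
  define M where "M = mat\<^sub>r n n (\<lambda>i. if i = n - 1 then 0\<^sub>v n else c i)"
  have M: "M \<in> carrier_mat n n" unfolding M_def by simp
  have "det M = 0" unfolding M_def
    by (rule det_row_0) (use k f in \<open>auto simp: c_def\<close>)
  then obtain v where v: "v \<in> carrier_vec n" "v \<noteq> 0\<^sub>v n" "M *\<^sub>v v = 0\<^sub>v n"
    using det_0_iff_vec_prod_zero_field[OF M] by blast
  have "v \<bullet>c f i = 0" if "i < k" for i
  proof -
    have "row M i = conjugate (f i)"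
      using that k f[OF that] by (auto simp: M_def c_def)
    then have "(M *\<^sub>v v) $ i = conjugate (f i) \<bullet> v"
      using that k M by simp
    also have "\<dots> = v \<bullet>c f i"
      using f[OF that] v(1) by (intro comm_scalar_prod[of _ n]) auto
    finally show ?thesis using v(3) that k by simp
  qed
  with v show ?thesis by blast
qed

lemma exists_unit_multiple:
  assumes v: "v \<in> carrier_vec n" "v \<noteq> 0\<^sub>v n"
  shows "\<exists>c. (c \<cdot>\<^sub>v v) \<bullet>c (c \<cdot>\<^sub>v v) = (1 :: complex)"
proof -
  let ?c = "complex_of_real (1 / sqrt (nsq v))"
  have pos: "0 < nsq v" using nsq_pos[OF v] .
  have "(?c \<cdot>\<^sub>v v) \<bullet>c (?c \<cdot>\<^sub>v v) = ?c * ?c * (v \<bullet>c v)"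
    using v by (simp add: conjugate_smult_vec)
  also have "\<dots> = complex_of_real (1 / sqrt (nsq v) * (1 / sqrt (nsq v)) * nsq v)"
    unfolding inner_self[OF v(1)] by (simp only: of_real_mult)
  also have "\<dots> = 1" using pos by simp
  finally show ?thesis by blast
qed

text \<open>Families are indexed by all naturals and only their first members matter, which lets them be
  extended and permuted by operations on functions.\<close>
definition orthonormal :: "nat \<Rightarrow> nat \<Rightarrow> (nat \<Rightarrow> complex vec) \<Rightarrow> bool" where
  "orthonormal n k u \<longleftrightarrow> (\<forall>i<k. u i \<in> carrier_vec n) \<and>
     (\<forall>i<k. \<forall>j<k. u i \<bullet>c u j = (if i = j then 1 else 0))"

lemma inner_commute_zero:
  "x \<in> carrier_vec n \<Longrightarrow> y \<in> carrier_vec n \<Longrightarrow> x \<bullet>c y = 0 \<Longrightarrow> y \<bullet>c (x :: complex vec) = 0"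
  by (metis conjugate_vec_sprod_comm conjugate_zero conjugate_sprod_vec conjugate_id carrier_vec_conjugate)

lemma orthonormal_snoc:
  assumes u: "orthonormal n k u" and v: "v \<in> carrier_vec n" "v \<noteq> 0\<^sub>v n"
    and orth: "\<And>i. i < k \<Longrightarrow> v \<bullet>c u i = 0"
  shows "\<exists>c. orthonormal n (Suc k) (u(k := c \<cdot>\<^sub>v v))"
proof -
  obtain c where c: "(c \<cdot>\<^sub>v v) \<bullet>c (c \<cdot>\<^sub>v v) = 1" using exists_unit_multiple[OF v] by blast
  have uc: "\<And>i. i < k \<Longrightarrow> u i \<in> carrier_vec n" using u by (auto simp: orthonormal_def)
  have 1: "(c \<cdot>\<^sub>v v) \<bullet>c u i = 0" if "i < k" for i
    using orth[OF that] v uc[OF that] by simp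
  have 2: "u i \<bullet>c (c \<cdot>\<^sub>v v) = 0" if "i < k" for i
    by (rule inner_commute_zero[OF _ _ 1[OF that]]) (use v uc that in auto)
  have "orthonormal n (Suc k) (u(k := c \<cdot>\<^sub>v v))"
    using u c v 1 2 unfolding orthonormal_def by (auto simp: less_Suc_eq)
  then show ?thesis by blast
qed

lemma orthonormal_complete:
  assumes "orthonormal n k u" "k \<le> n"
  shows "\<exists>u'. orthonormal n n u' \<and> (\<forall>i<k. u' i = u i)"
  using assms
proof (induction "n - k" arbitrary: k u)
  case 0
  then show ?case by auto
next
  case (Suc m)
  then have k: "k < n" by simp
  obtain v where v: "v \<in> carrier_vec n" "v \<noteq> 0\<^sub>v n" "\<forall>i<k. v \<bullet>c u i = 0"
    using exists_orthogonal[OF k, of u] Suc.prems by (auto simp: orthonormal_def)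
  then obtain c where c: "orthonormal n (Suc k) (u(k := c \<cdot>\<^sub>v v))"
    using orthonormal_snoc[OF Suc.prems(1)] by blast
  have m: "m = n - Suc k" using Suc.hyps(2) by simp
  obtain u' where "orthonormal n n u'" "\<forall>i<Suc k. u' i = (u(k := c \<cdot>\<^sub>v v)) i"
    using Suc.hyps(1)[OF m c] k by (metis Suc_leI)
  then show ?case by (intro exI[of _ u']) auto
qed

definition fam_mat :: "nat \<Rightarrow> nat \<Rightarrow> (nat \<Rightarrow> complex vec) \<Rightarrow> complex mat" where
  "fam_mat n m u = mat n m (\<lambda>(i, j). u j $ i)"

lemma fam_mat_dim [simp]: "dim_row (fam_mat n m u) = n" "dim_col (fam_mat n m u) = m"
  "fam_mat n m u \<in> carrier_mat n m"
  by (auto simp: fam_mat_def)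

lemma col_fam_mat:
  "u j \<in> carrier_vec n \<Longrightarrow> j < m \<Longrightarrow> col (fam_mat n m u) j = u j"
  by (rule eq_vecI) (auto simp: fam_mat_def)

lemma adj_fam_mat_mult:
  assumes "x \<in> carrier_vec n" "u j \<in> carrier_vec n" "j < m"
  shows "(adj (fam_mat n m u) *\<^sub>v x) $ j = x \<bullet>c u j"
  using assms adj_mult_vec_index[of "fam_mat n m u" n m x j] by (simp add: col_fam_mat)

lemma isometry_fam_mat:
  assumes "orthonormal n m u" "m \<le> n"
  shows "isometry_mat n m (fam_mat n m u)"
proof -
  have "(adj (fam_mat n m u) * fam_mat n m u) $$ (i, j) = (if i = j then 1 else 0)" if "i < m" "j < m" for i j
  proof -
    have "col (fam_mat n m u) j = u j"
      using assms that by (intro col_fam_mat) (auto simp: orthonormal_def)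
    then have "(adj (fam_mat n m u) * fam_mat n m u) $$ (i, j) = (adj (fam_mat n m u) *\<^sub>v u j) $ i"
      using that by simp
    also have "\<dots> = u j \<bullet>c u i"
      using assms that by (intro adj_fam_mat_mult) (auto simp: orthonormal_def)
    finally show ?thesis using assms that by (auto simp: orthonormal_def)
  qed
  then have "adj (fam_mat n m u) * fam_mat n m u = 1\<^sub>m m"
    by (intro eq_matI) auto
  then show ?thesis using assms by (auto simp: isometry_mat_def)
qed

text \<open>The orthogonal complement of the eigenvectors found so far is invariant under \<open>H\<close>. Hence an
  eigenvector of the compression of \<open>H\<close> to that complement is an eigenvector of \<open>H\<close>: the residual
  \<open>H v - \<mu> v\<close> is orthogonal to a whole orthonormal basis.\<close>
lemma eigenfamily_extend:
  assumes H: "H \<in> carrier_mat n n" "hermitian_mat H"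
    and u: "orthonormal n k u" and eig: "\<And>i. i < k \<Longrightarrow> H *\<^sub>v u i = complex_of_real (l i) \<cdot>\<^sub>v u i"
    and k: "k < n"
  shows "\<exists>v \<mu>. orthonormal n (Suc k) (u(k := v)) \<and> H *\<^sub>v v = complex_of_real \<mu> \<cdot>\<^sub>v v"
proof -
  obtain w where w: "orthonormal n n w" and wu: "\<And>i. i < k \<Longrightarrow> w i = u i"
    using orthonormal_complete[OF u] k by auto
  have wc: "\<And>i. i < n \<Longrightarrow> w i \<in> carrier_vec n" using w by (auto simp: orthonormal_def)
  \<comment> \<open>The columns of \<open>W\<close> span the orthogonal complement of the given eigenvectors.\<close>
  define W where "W = fam_mat n (n - k) (\<lambda>j. w (k + j))"
  have W: "isometry_mat n (n - k) W" unfolding W_def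
    by (rule isometry_fam_mat) (use w in \<open>auto simp: orthonormal_def\<close>)
  note W' = isometryD[OF W]
  define M where "M = adj W * (H * W)"
  have M: "M \<in> carrier_mat (n - k) (n - k)" using W' H by (auto simp: M_def)
  obtain \<mu> y where y: "y \<in> carrier_vec (n - k)" "y \<noteq> 0\<^sub>v (n - k)" "M *\<^sub>v y = \<mu> \<cdot>\<^sub>v y"
    using spectrum_non_empty[OF M] k M by (auto simp: spectrum_def eigenvalue_def eigenvector_def)
  define v where "v = W *\<^sub>v y"
  have v: "v \<in> carrier_vec n" using W' by (simp add: v_def)
  have v0: "v \<noteq> 0\<^sub>v n"
  proof
    assume "v = 0\<^sub>v n"
    then have "nsq v = 0" by (simp add: nsq_def)
    then have "nsq y = 0" using nsq_isometry[OF W y(1)] by (simp add: v_def)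
    then show False using nsq_pos[OF y(1,2)] by simp
  qed
  have adjW: "(adj W *\<^sub>v x) $ j = x \<bullet>c w (k + j)" if "x \<in> carrier_vec n" "j < n - k" for x j
    unfolding W_def by (rule adj_fam_mat_mult) (use that wc in auto)
  have vu: "v \<bullet>c u i = 0" if "i < k" for i
  proof -
    have ui: "u i \<in> carrier_vec n" using u that by (auto simp: orthonormal_def)
    have "adj W *\<^sub>v u i = 0\<^sub>v (n - k)"
    proof (rule eq_vecI)
      fix j assume "j < dim_vec (0\<^sub>v (n - k) :: complex vec)"
      then show "(adj W *\<^sub>v u i) $ j = 0\<^sub>v (n - k) $ j"
        using adjW[OF ui, of j] w that unfolding orthonormal_def wu[OF that, symmetric] by simp
    qed (use W' in auto)
    then show ?thesis unfolding v_def using adj_inner[OF W'(1) y(1) ui] y by simp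
  qed
  define z where "z = H *\<^sub>v v - \<mu> \<cdot>\<^sub>v v"
  have z: "z \<in> carrier_vec n" using H v by (simp add: z_def)
  have Hv: "H *\<^sub>v v \<in> carrier_vec n" using H by simp
  have zw: "z \<bullet>c w i = 0" if i: "i < n" for i
  proof (cases "i < k")
    case True
    have ui: "u i \<in> carrier_vec n" using u True by (auto simp: orthonormal_def)
    have "(H *\<^sub>v v) \<bullet>c u i = v \<bullet>c (H *\<^sub>v u i)"
      using adj_inner[OF H(1) v ui] H(2) by (simp add: hermitian_mat_def)
    also have "\<dots> = 0" using vu[OF True] v ui by (simp add: eig[OF True] conjugate_smult_vec)
    finally show ?thesis
      using vu[OF True] v ui Hv unfolding z_def wu[OF True]
      by (subst minus_scalar_prod_distrib[of _ n]) auto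
  next
    case False
    have "adj W *\<^sub>v z = adj W *\<^sub>v (H *\<^sub>v v) - \<mu> \<cdot>\<^sub>v (adj W *\<^sub>v v)"
      unfolding z_def using W' v Hv
      by (subst mult_minus_distrib_mat_vec[of _ "n - k" n]) (auto simp: mult_mat_vec[of _ "n - k" n])
    also have "adj W *\<^sub>v (H *\<^sub>v v) = M *\<^sub>v y"
      unfolding M_def v_def using W' H y by (simp add: mat_vec_assoc)
    also have "adj W *\<^sub>v v = y"
      unfolding v_def using W' y by (simp add: mat_vec_assoc[symmetric])
    finally have "adj W *\<^sub>v z = 0\<^sub>v (n - k)" using y by simp
    then show ?thesis using adjW[OF z, of "i - k"] False i by simp
  qed
  have "z = 0\<^sub>v n"
  proof -
    define U where "U = fam_mat n n w"
    have U: "unitary_mat n U" unfolding U_def by (rule isometry_fam_mat[OF w]) simp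
    have "adj U *\<^sub>v z = 0\<^sub>v n"
      using adj_fam_mat_mult[OF z wc] zw by (intro eq_vecI) (auto simp: U_def simp del: index_mult_mat_vec)
    then have "U *\<^sub>v (adj U *\<^sub>v z) = 0\<^sub>v n" using unitaryD[OF U] by (intro eq_vecI) auto
    then show ?thesis using unitaryD[OF U] z by (simp add: mat_vec_assoc[symmetric])
  qed
  then have Hv\<mu>: "H *\<^sub>v v = \<mu> \<cdot>\<^sub>v v"
  proof (intro eq_vecI)
    fix i assume "i < dim_vec (\<mu> \<cdot>\<^sub>v v)"
    then have i: "i < n" using v by simp
    have "z $ i = 0" using \<open>z = 0\<^sub>v n\<close> i by simp
    then show "(H *\<^sub>v v) $ i = (\<mu> \<cdot>\<^sub>v v) $ i" using i v Hv unfolding z_def by simp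
  qed (use H v in auto)
  have "\<mu> * (v \<bullet>c v) = cnj \<mu> * (v \<bullet>c v)"
  proof -
    have "(H *\<^sub>v v) \<bullet>c v = v \<bullet>c (H *\<^sub>v v)"
      using adj_inner[OF H(1) v v] H(2) by (simp add: hermitian_mat_def)
    then show ?thesis using v by (simp add: Hv\<mu> conjugate_smult_vec)
  qed
  moreover have "v \<bullet>c v \<noteq> 0"
    using inner_self[OF v] nsq_pos[OF v v0] by simp
  ultimately have "\<mu> = cnj \<mu>" by (metis mult_cancel_right)
  then have "\<mu> = complex_of_real (Re \<mu>)" by (simp add: complex_eq_iff)
  moreover obtain c where "orthonormal n (Suc k) (u(k := c \<cdot>\<^sub>v v))"
    using orthonormal_snoc[OF u v v0 vu] by blast
  moreover have "H *\<^sub>v (c \<cdot>\<^sub>v v) = \<mu> \<cdot>\<^sub>v (c \<cdot>\<^sub>v v)"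
    using H v by (simp add: mult_mat_vec[of _ n n] Hv\<mu> smult_smult_assoc mult.commute)
  ultimately show ?thesis by metis
qed

lemma hermitian_eigenfamily:
  assumes H: "H \<in> carrier_mat n n" "hermitian_mat H" and "k \<le> n"
  shows "\<exists>u l. orthonormal n k u \<and> (\<forall>i<k. H *\<^sub>v u i = complex_of_real (l i) \<cdot>\<^sub>v u i)"
  using assms(3)
proof (induction k)
  case 0
  show ?case by (auto simp: orthonormal_def)
next
  case (Suc k)
  then obtain u l where u: "orthonormal n k u" "\<And>i. i < k \<Longrightarrow> H *\<^sub>v u i = complex_of_real (l i) \<cdot>\<^sub>v u i"
    by auto
  obtain v \<mu> where "orthonormal n (Suc k) (u(k := v))" "H *\<^sub>v v = complex_of_real \<mu> \<cdot>\<^sub>v v"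
    using eigenfamily_extend[OF H u] Suc.prems by auto
  then show ?case using u(2)
    by (intro exI[of _ "u(k := v)"] exI[of _ "l(k := \<mu>)"]) (auto simp: less_Suc_eq simp del: fun_upd_apply, auto)
qed

lemma exists_sorting:
  fixes f :: "nat \<Rightarrow> real"
  shows "\<exists>p. bij_betw p {..<n} {..<n} \<and> (\<forall>i j. i \<le> j \<longrightarrow> j < n \<longrightarrow> f (p j) \<le> f (p i))"
proof -
  define xs where "xs = sort_key (\<lambda>i. - f i) [0..<n]"
  have xs: "length xs = n" "set xs = {..<n}" "distinct xs" by (auto simp: xs_def)
  have "sorted (map (\<lambda>i. - f i) xs)" by (simp add: xs_def)
  then have "f (xs ! j) \<le> f (xs ! i)" if "i \<le> j" "j < n" for i j
    using that xs sorted_nth_mono[of "map (\<lambda>i. - f i) xs" i j] by simp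
  moreover have "bij_betw ((!) xs) {..<n} {..<n}"
    using bij_betw_nth[OF xs(3)] xs by auto
  ultimately show ?thesis by blast
qed

text \<open>The eigenvalues are sorted by the values of a function \<open>f\<close>. For a decreasing \<open>g\<close> the decreasing
  order of the values \<open>g l\<close> reverses the order of the \<open>l\<close>, so that sorting by \<open>f = g\<close> lets
  increasing and decreasing \<open>g\<close> be handled uniformly.\<close>
lemma hermitian_spectral_sorted:
  assumes H: "H \<in> carrier_mat n n" "hermitian_mat H"
  shows "\<exists>U l. unitary_mat n U \<and> H = U * real_diag n l * adj U \<and>
    (\<forall>i j. i \<le> j \<longrightarrow> j < n \<longrightarrow> (f :: real \<Rightarrow> real) (l j) \<le> f (l i))"
proof -
  obtain u0 l0 where u0: "orthonormal n n u0" "\<And>i. i < n \<Longrightarrow> H *\<^sub>v u0 i = complex_of_real (l0 i) \<cdot>\<^sub>v u0 i"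
    using hermitian_eigenfamily[OF H order_refl] by auto
  obtain p where p: "bij_betw p {..<n} {..<n}" "\<And>i j. i \<le> j \<Longrightarrow> j < n \<Longrightarrow> f (l0 (p j)) \<le> f (l0 (p i))"
    using exists_sorting[of n "f \<circ> l0"] by auto
  define u l where "u = u0 \<circ> p" and "l = l0 \<circ> p"
  have pn: "p i < n" if "i < n" for i using p(1) that by (auto simp: bij_betw_def)
  have pinj: "p i = p j \<longleftrightarrow> i = j" if "i < n" "j < n" for i j
    using p(1) that by (auto simp: bij_betw_def inj_on_def)
  have u: "orthonormal n n u" using u0(1) pn pinj by (auto simp: orthonormal_def u_def)
  define U where "U = fam_mat n n u"
  have U: "unitary_mat n U" unfolding U_def by (rule isometry_fam_mat[OF u]) simp
  note U' = unitaryD[OF U]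
  have "H * U = U * real_diag n l"
  proof (rule eq_matI)
    fix i j assume "i < dim_row (U * real_diag n l)" "j < dim_col (U * real_diag n l)"
    then have ij: "i < n" "j < n" using U' by auto
    have col: "col U j = u j" using ij u unfolding U_def by (intro col_fam_mat) (auto simp: orthonormal_def)
    then have "(H * U) $$ (i, j) = (H *\<^sub>v u j) $ i" using ij H U' by simp
    also have "\<dots> = l j * U $$ (i, j)"
      using u0(2)[OF pn[OF ij(2)]] ij u
      by (auto simp add: u_def l_def U_def fam_mat_def orthonormal_def intro!: index_smult_vec)
    also have "\<dots> = (U * real_diag n l) $$ (i, j)"
      using ij U' by (simp add: mat_diag_mult_right[of _ n])
    finally show "(H * U) $$ (i, j) = (U * real_diag n l) $$ (i, j)" .
  qed (use H U' in auto)
  then have "H * U * adj U = U * real_diag n l * adj U" by simp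
  then have "H = U * real_diag n l * adj U" using H U' by (simp add: mat_assoc)
  with U p(2) show ?thesis unfolding l_def by (metis comp_apply)
qed

section \<open>The spectral functional calculus\<close>

lemma isometry_cancel: "isometry_mat n m V \<Longrightarrow> dim_row X = m \<Longrightarrow> adj V * (V * X) = X"
  using isometryD[of n m V] by (simp add: mat_assoc[symmetric])

lemma unitary_cancel: "unitary_mat n U \<Longrightarrow> dim_row X = n \<Longrightarrow> U * (adj U * X) = X"
  using unitaryD[of n U] by (simp add: mat_assoc[symmetric])

lemma hermitian_spectral:
  assumes "H \<in> carrier_mat n n" "hermitian_mat H"
  obtains U l where "unitary_mat n U" "H = U * real_diag n l * adj U"
  using hermitian_spectral_sorted[OF assms, of "\<lambda>_. 0"] by blast

lemma hermitian_conj: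
  assumes "A \<in> carrier_mat m m" "hermitian_mat A" "B \<in> carrier_mat n m"
  shows "hermitian_mat (B * A * adj B)"
  using assms by (simp add: hermitian_mat_def adj_mult mat_assoc)

lemma hermitian_real_diag: "hermitian_mat (real_diag n l)"
  by (simp add: hermitian_mat_def)

text \<open>An entry of \<open>X\<close> can be nonzero only where the two diagonals agree, and there so do their images
  under \<open>f\<close>.\<close>
lemma diag_intertwine:
  assumes X: "X \<in> carrier_mat n p" and eq: "real_diag n k * X = X * real_diag p l"
  shows "real_diag n (\<lambda>i. f (k i)) * X = X * real_diag p (\<lambda>i. f (l i))"
proof -
  have "complex_of_real (f (k i)) * X $$ (i, j) = X $$ (i, j) * complex_of_real (f (l j))"
    if "i < n" "j < p" for i j
  proof -
    have "(real_diag n k * X) $$ (i, j) = (X * real_diag p l) $$ (i, j)" by (simp add: eq)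
    then have "complex_of_real (k i) * X $$ (i, j) = X $$ (i, j) * complex_of_real (l j)"
      using that X by (simp add: mat_diag_mult_left[OF X] mat_diag_mult_right[OF X])
    then have "X $$ (i, j) = 0 \<or> k i = l j" by auto
    then show ?thesis by auto
  qed
  then show ?thesis
    using X by (intro eq_matI) (auto simp: mat_diag_mult_left[OF X] mat_diag_mult_right[OF X])
qed

text \<open>Taking \<open>X = 1\<close> shows that the functional calculus does not depend on the diagonalisation.\<close>
lemma spectral_intertwine:
  assumes W: "unitary_mat n W" and U: "unitary_mat p U" and X: "X \<in> carrier_mat n p"
    and eq: "W * real_diag n k * adj W * X = X * (U * real_diag p l * adj U)"
  shows "W * real_diag n (\<lambda>i. f (k i)) * adj W * X = X * (U * real_diag p (\<lambda>i. f (l i)) * adj U)"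
proof -
  note W' = unitaryD[OF W] and U' = unitaryD[OF U]
  define Y where "Y = adj W * X * U"
  have Y: "Y \<in> carrier_mat n p" using W' U' by (simp add: Y_def)
  have "real_diag n k * Y = adj W * (W * real_diag n k * adj W * X) * U"
    using W' U' X by (simp add: Y_def mat_assoc isometry_cancel[OF W])
  also have "\<dots> = Y * real_diag p l"
    unfolding eq using W' U' X by (simp add: Y_def mat_assoc)
  finally have d: "real_diag n (\<lambda>i. f (k i)) * Y = Y * real_diag p (\<lambda>i. f (l i))"
    by (rule diag_intertwine[OF Y])
  have "W * real_diag n (\<lambda>i. f (k i)) * adj W * X = W * (real_diag n (\<lambda>i. f (k i)) * Y) * adj U"
    using W' U' X by (simp add: Y_def mat_assoc)
  also have "\<dots> = X * (U * real_diag p (\<lambda>i. f (l i)) * adj U)"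
    unfolding d using W' U' X by (simp add: Y_def mat_assoc unitary_cancel[OF W])
  finally show ?thesis .
qed

lemma mat_fun_spectral:
  assumes U: "unitary_mat n U"
  shows "mat_fun f (U * real_diag n l * adj U) = U * real_diag n (\<lambda>i. f (l i)) * adj U"
proof -
  note U' = unitaryD[OF U]
  have uniq: "W * real_diag n (\<lambda>i. f (k i)) * adj W = U * real_diag n (\<lambda>i. f (l i)) * adj U"
    if W: "unitary_mat n W" and eq: "U * real_diag n l * adj U = W * real_diag n k * adj W" for W k
  proof -
    note W' = unitaryD[OF W]
    have "W * real_diag n k * adj W * 1\<^sub>m n = 1\<^sub>m n * (U * real_diag n l * adj U)"
      unfolding eq using W' by (simp add: mat_assoc)
    from spectral_intertwine[OF W U one_carrier_mat this, of f] show ?thesis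
      using W' U' by (simp add: mat_assoc)
  qed
  have dim: "dim_row (U * real_diag n l * adj U) = n" using U'(1) by simp
  show ?thesis
    unfolding mat_fun_def Let_def dim
  proof (rule the_equality)
    show "\<exists>W k. unitary_mat n W \<and> U * real_diag n l * adj U = W * real_diag n k * adj W \<and>
      U * real_diag n (\<lambda>i. f (l i)) * adj U = W * real_diag n (\<lambda>i. f (k i)) * adj W"
      using U by blast
  next
    fix B
    assume "\<exists>W k. unitary_mat n W \<and> U * real_diag n l * adj U = W * real_diag n k * adj W \<and>
      B = W * real_diag n (\<lambda>i. f (k i)) * adj W"
    then show "B = U * real_diag n (\<lambda>i. f (l i)) * adj U"
      using uniq by blast
  qed
qed

lemma mat_fun_carrier [simp]:
  assumes "H \<in> carrier_mat n n" "hermitian_mat H"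
  shows "mat_fun f H \<in> carrier_mat n n" "hermitian_mat (mat_fun f H)"
proof -
  obtain U l where U: "unitary_mat n U" and H: "H = U * real_diag n l * adj U"
    using hermitian_spectral[OF assms] .
  note U' = unitaryD[OF U]
  show "mat_fun f H \<in> carrier_mat n n"
    unfolding H mat_fun_spectral[OF U] using U'(1) by simp
  show "hermitian_mat (mat_fun f H)"
    unfolding H mat_fun_spectral[OF U] by (rule hermitian_conj[OF mat_diag_dim hermitian_real_diag U'(1)])
qed

text \<open>For polynomials \<open>f\<close> this is immediate; in general it follows from the diagonal case. It yields
  unitary invariance and, more generally, compatibility with isometries.\<close>
lemma mat_fun_intertwine:
  assumes H: "H \<in> carrier_mat n n" "hermitian_mat H" and K: "K \<in> carrier_mat p p" "hermitian_mat K"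
    and X: "X \<in> carrier_mat n p" and eq: "H * X = X * K"
  shows "mat_fun f H * X = X * mat_fun f K"
proof -
  obtain W k where W: "unitary_mat n W" and Hk: "H = W * real_diag n k * adj W"
    using hermitian_spectral[OF H] .
  obtain U l where U: "unitary_mat p U" and Kl: "K = U * real_diag p l * adj U"
    using hermitian_spectral[OF K] .
  have "mat_fun f H = W * real_diag n (\<lambda>i. f (k i)) * adj W"
    unfolding Hk by (rule mat_fun_spectral[OF W])
  moreover have "mat_fun f K = U * real_diag p (\<lambda>i. f (l i)) * adj U"
    unfolding Kl by (rule mat_fun_spectral[OF U])
  ultimately show ?thesis
    using spectral_intertwine[OF W U X eq[unfolded Hk Kl], of f] by simp
qed

lemma mat_fun_comp:
  assumes "H \<in> carrier_mat n n" "hermitian_mat H"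
  shows "mat_fun f (mat_fun g H) = mat_fun (\<lambda>t. f (g t)) H"
proof -
  obtain U l where U: "unitary_mat n U" and H: "H = U * real_diag n l * adj U"
    using hermitian_spectral[OF assms] .
  show ?thesis unfolding H mat_fun_spectral[OF U] ..
qed

lemma mat_fun_zero:
  assumes "f 0 = 0"
  shows "mat_fun f (0\<^sub>m n n) = 0\<^sub>m n n"
proof -
  have z: "mat_diag n (\<lambda>_. 0 :: complex) = 0\<^sub>m n n" by (rule eq_matI) (auto simp: mat_diag_def)
  have U: "unitary_mat n (1\<^sub>m n)" by (simp add: isometry_mat_def)
  show ?thesis using mat_fun_spectral[OF U, of f "\<lambda>_. 0"] assms by (simp add: z)
qed

text \<open>The matrix \<open>P\<close> intertwines \<open>P Z P\<^sup>*\<close> with \<open>Z\<close>, which settles the range of \<open>P\<close>. On the orthogonal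
  complement, \<open>Q = 1 - P P\<^sup>*\<close> intertwines \<open>P Z P\<^sup>*\<close> with \<open>0\<close>, and \<open>f(0) = 0\<close> since \<open>f 0 = 0\<close>.\<close>
lemma mat_fun_isometry:
  assumes P: "isometry_mat n p P" and Z: "Z \<in> carrier_mat p p" "hermitian_mat Z" and f: "f 0 = 0"
  shows "mat_fun f (P * Z * adj P) = P * mat_fun f Z * adj P"
proof -
  note P' = isometryD[OF P]
  define H where "H = P * Z * adj P"
  have H: "H \<in> carrier_mat n n" "hermitian_mat H"
    using P' Z by (auto simp: H_def hermitian_conj)
  define Q where "Q = 1\<^sub>m n - P * adj P"
  have Q: "Q \<in> carrier_mat n n" unfolding Q_def using P'(1) by (intro carrier_matI) auto
  have "adj P * Q = adj P * 1\<^sub>m n - adj P * (P * adj P)"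
    unfolding Q_def using P' by (intro mult_minus_distrib_mat[of _ p n _ n]) auto
  also have "\<dots> = 0\<^sub>m p n"
    using P' by (simp add: isometry_cancel[OF P] right_mult_one_mat[of _ p n])
  finally have "H * Q = 0\<^sub>m n n"
    using P' Z Q by (simp add: H_def mat_assoc)
  then have "H * Q = Q * 0\<^sub>m n n" using Q by simp
  moreover have "hermitian_mat (0\<^sub>m n n)"
    unfolding hermitian_mat_def by (rule eq_matI) auto
  ultimately have "mat_fun f H * Q = 0\<^sub>m n n"
    using mat_fun_intertwine[OF H _ _ Q, of "0\<^sub>m n n" f] Q mat_fun_zero[of f n] f by simp
  moreover have "mat_fun f H * Q = mat_fun f H * 1\<^sub>m n - mat_fun f H * (P * adj P)"
    unfolding Q_def using P' mat_fun_carrier[OF H] by (intro mult_minus_distrib_mat[of _ n n _ n]) auto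
  ultimately have "mat_fun f H - mat_fun f H * (P * adj P) = 0\<^sub>m n n"
    using mat_fun_carrier[OF H] by (simp add: right_mult_one_mat[of _ n n])
  then have 1: "mat_fun f H = mat_fun f H * (P * adj P)"
    using P' mat_fun_carrier[OF H, of f]
    by (intro eq_matI) (auto simp: mat_eq_iff simp del: index_mult_mat(1))
  have "H * P = P * Z"
    using P' Z by (simp add: H_def mat_assoc)
  from mat_fun_intertwine[OF H Z P'(1) this, of f]
  have "mat_fun f H * (P * adj P) = P * mat_fun f Z * adj P"
    using P' mat_fun_carrier[OF H, of f] by (simp add: mat_assoc[symmetric])
  with 1 show ?thesis by (simp add: H_def)
qed

section \<open>Comparing eigenvalues by the min-max principle\<close>

lemma nsq_unitary_adj: "unitary_mat n U \<Longrightarrow> x \<in> carrier_vec n \<Longrightarrow> nsq (adj U *\<^sub>v x) = nsq x"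
  by (rule nsq_isometry[OF unitary_adj])

lemma unitary_cancel_vec:
  "isometry_mat n m V \<Longrightarrow> x \<in> carrier_vec m \<Longrightarrow> adj V *\<^sub>v (V *\<^sub>v x) = x"
  using isometryD[of n m V] by (simp add: mat_vec_assoc[symmetric])

text \<open>One half of the Courant-Fischer principle. The image under \<open>X\<close> of the vectors supported on
  the coordinates \<open>0, \<dots>, i\<close> has dimension \<open>i + 1\<close>, as \<open>X\<close> is injective on them, so it meets the orthogonal complement of the first
  \<open>i\<close> eigenvectors, where the quadratic form is at most \<open>\<nu> i\<close> times the squared norm. Allowing an
  arbitrary \<open>X\<close>, not only a unitary one, makes the lemma applicable to images of eigenvectors that are
  orthogonal but not normalised.\<close>
lemma min_max_bound:
  assumes V: "unitary_mat n V" and \<nu>: "\<And>i j. i \<le> j \<Longrightarrow> j < n \<Longrightarrow> \<nu> j \<le> \<nu> i" and i: "i < n"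
    and X: "X \<in> carrier_mat n n"
    and bound: "\<And>c. c \<in> carrier_vec n \<Longrightarrow> c \<noteq> 0\<^sub>v n \<Longrightarrow> (\<And>j. i < j \<Longrightarrow> j < n \<Longrightarrow> c $ j = 0) \<Longrightarrow>
      0 < nsq (X *\<^sub>v c) \<and> t * nsq (X *\<^sub>v c) \<le> qf (V * real_diag n \<nu> * adj V) (X *\<^sub>v c)"
  shows "t \<le> \<nu> i"
proof -
  note V' = unitaryD[OF V]
  \<comment> \<open>In all \<open>n - 1\<close> conditions: \<open>i\<close> of them make \<open>X c\<close> orthogonal to the first \<open>i\<close> eigenvectors, the
    other \<open>n - 1 - i\<close> make the coordinates of \<open>c\<close> after \<open>i\<close> vanish.\<close>
  define f where "f = (\<lambda>a. if a < i then adj X *\<^sub>v col V a else unit_vec n (Suc a))"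
  have "\<exists>c. c \<in> carrier_vec n \<and> c \<noteq> 0\<^sub>v n \<and> (\<forall>a<n - 1. c \<bullet>c f a = 0)"
    by (rule exists_orthogonal) (use i X in \<open>auto simp: f_def\<close>)
  then obtain c where c: "c \<in> carrier_vec n" "c \<noteq> 0\<^sub>v n" and orth: "\<And>a. a < n - 1 \<Longrightarrow> c \<bullet>c f a = 0"
    by blast
  have supp: "c $ j = 0" if "i < j" "j < n" for j
  proof -
    obtain j' where j': "j = Suc j'" using \<open>i < j\<close> by (cases j) auto
    have "0 = c \<bullet>c unit_vec n j" using orth[of j'] that by (simp add: f_def j')
    also have "\<dots> = (\<Sum>k<n. if k = j then c $ k else 0)"
      using that c by (subst inner_sum[of _ n], simp_all only: unit_vec_carrier)
        (rule sum.cong, auto simp: unit_vec_def)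
    finally show ?thesis using that by simp
  qed
  define x where "x = X *\<^sub>v c"
  have x: "x \<in> carrier_vec n" using X by (simp add: x_def)
  have zero: "(adj V *\<^sub>v x) $ a = 0" if "a < i" for a
  proof -
    have "(adj V *\<^sub>v x) $ a = x \<bullet>c col V a"
      using that i by (intro adj_mult_vec_index[OF V'(1) x]) simp
    also have "\<dots> = c \<bullet>c (adj X *\<^sub>v col V a)"
      unfolding x_def using V'(1) that i by (intro adj_inner[OF X c(1)]) auto
    also have "\<dots> = 0" using orth[of a] that i by (simp add: f_def)
    finally show ?thesis .
  qed
  have "qf (V * real_diag n \<nu> * adj V) x = (\<Sum>a<n. \<nu> a * (cmod ((adj V *\<^sub>v x) $ a))\<^sup>2)"
    by (rule qf_spectral[OF V'(1) x])
  also have "\<dots> \<le> (\<Sum>a<n. \<nu> i * (cmod ((adj V *\<^sub>v x) $ a))\<^sup>2)"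
  proof (rule sum_mono)
    fix a assume "a \<in> {..<n}"
    then show "\<nu> a * (cmod ((adj V *\<^sub>v x) $ a))\<^sup>2 \<le> \<nu> i * (cmod ((adj V *\<^sub>v x) $ a))\<^sup>2"
    proof (cases "a < i")
      case False
      then have "\<nu> a \<le> \<nu> i" using \<nu>[of i a] \<open>a \<in> {..<n}\<close> by simp
      then show ?thesis by (intro mult_right_mono) auto
    qed (simp add: zero del: index_mult_mat_vec)
  qed
  also have "\<dots> = \<nu> i * nsq (adj V *\<^sub>v x)"
    using V'(1) by (subst nsq_sum[of _ n]) (auto simp: sum_distrib_left)
  also have "\<dots> = \<nu> i * nsq x" by (simp add: nsq_unitary_adj[OF V x])
  finally have upper: "qf (V * real_diag n \<nu> * adj V) x \<le> \<nu> i * nsq x" .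
  have lower: "0 < nsq x" "t * nsq x \<le> qf (V * real_diag n \<nu> * adj V) x"
    using bound[OF c supp] unfolding x_def by blast+
  from lower(2) upper have "t * nsq x \<le> \<nu> i * nsq x" by linarith
  then show ?thesis using lower(1) by (rule mult_right_le_imp_le)
qed

text \<open>The unitary \<open>V W\<^sup>*\<close> carries one eigenbasis to the other, after which both forms are diagonal in
  the same coordinates.\<close>
lemma eigenvalue_order_imp_orbit_le:
  assumes V: "unitary_mat n V" and W: "unitary_mat n W" and le: "\<And>i. i < n \<Longrightarrow> b i \<le> \<nu> i"
  shows "\<exists>U. unitary_mat n U \<and> (\<forall>x\<in>carrier_vec n.
    qf (W * real_diag n b * adj W) (adj U *\<^sub>v x) \<le> qf (V * real_diag n \<nu> * adj V) x)"
proof (intro exI conjI ballI)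
  note V' = unitaryD[OF V] and W' = unitaryD[OF W]
  show "unitary_mat n (V * adj W)" by (rule isometry_mult[OF V unitary_adj[OF W]])
  fix x :: "complex vec" assume x: "x \<in> carrier_vec n"
  have 1: "adj (V * adj W) *\<^sub>v x = W *\<^sub>v (adj V *\<^sub>v x)"
    using V' W' x by (simp add: adj_mult mat_vec_assoc)
  have 2: "adj W *\<^sub>v (W *\<^sub>v (adj V *\<^sub>v x)) = adj V *\<^sub>v x"
    using V' x by (intro unitary_cancel_vec[OF W]) simp
  have "qf (W * real_diag n b * adj W) (adj (V * adj W) *\<^sub>v x) = (\<Sum>i<n. b i * (cmod ((adj V *\<^sub>v x) $ i))\<^sup>2)"
    unfolding 1 using V' W' x by (subst qf_spectral[of _ n]) (auto simp: 2 simp del: index_mult_mat_vec)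
  also have "\<dots> \<le> (\<Sum>i<n. \<nu> i * (cmod ((adj V *\<^sub>v x) $ i))\<^sup>2)"
    using le by (intro sum_mono mult_right_mono) auto
  also have "\<dots> = qf (V * real_diag n \<nu> * adj V) x"
    by (rule qf_spectral[OF V'(1) x, symmetric])
  finally show "qf (W * real_diag n b * adj W) (adj (V * adj W) *\<^sub>v x) \<le> qf (V * real_diag n \<nu> * adj V) x" .
qed

lemma qf_spectral_apply:
  assumes W: "unitary_mat n W" and c: "c \<in> carrier_vec n"
  shows "qf (W * real_diag n b * adj W) (W *\<^sub>v c) = (\<Sum>j<n. b j * (cmod (c $ j))\<^sup>2)"
  using unitaryD(1)[OF W] c
  by (subst qf_spectral[of _ n]) (auto simp: unitary_cancel_vec[OF W c] simp del: index_mult_mat_vec)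

lemma eigenvalue_nonneg:
  assumes V: "unitary_mat n V" and psd: "\<And>x. x \<in> carrier_vec n \<Longrightarrow> 0 \<le> qf (V * real_diag n \<nu> * adj V) x"
    and i: "i < n"
  shows "0 \<le> \<nu> i"
proof -
  have "0 \<le> qf (V * real_diag n \<nu> * adj V) (V *\<^sub>v unit_vec n i)"
    using unitaryD(1)[OF V] by (intro psd) simp
  also have "\<dots> = (\<Sum>j<n. if j = i then \<nu> i else 0)"
    by (subst qf_spectral_apply[OF V], simp) (rule sum.cong, auto simp: unit_vec_def)
  finally show ?thesis using i by simp
qed

lemma gram_hermitian:
  assumes "B \<in> carrier_mat n m"
  shows "adj B * B \<in> carrier_mat m m" "hermitian_mat (adj B * B)"
    "x \<in> carrier_vec m \<Longrightarrow> 0 \<le> qf (adj B * B) x"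
  using assms
  by (auto simp: hermitian_mat_def adj_mult nsq_mult[of B n m, symmetric] intro!: nsq_nonneg[of _ n])

text \<open>If \<open>b i > 0\<close>, then \<open>B\<close> is injective on the span of the first \<open>i + 1\<close> eigenvectors of \<open>B\<^sup>* B\<close>,
  and on the image of this span the form of \<open>B B\<^sup>*\<close> is at least \<open>b i\<close> times the squared norm,
  because it involves \<open>b j\<^sup>2\<close> where the norm involves \<open>b j\<close>.\<close>
lemma gram_eigenvalues_le:
  assumes B: "B \<in> carrier_mat n n"
    and W: "unitary_mat n W" "adj B * B = W * real_diag n b * adj W" "\<And>i j. i \<le> j \<Longrightarrow> j < n \<Longrightarrow> b j \<le> b i"
    and V: "unitary_mat n V" "B * adj B = V * real_diag n \<nu> * adj V" "\<And>i j. i \<le> j \<Longrightarrow> j < n \<Longrightarrow> \<nu> j \<le> \<nu> i"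
    and i: "i < n"
  shows "b i \<le> \<nu> i"
proof (cases "b i \<le> 0")
  case True
  have "0 \<le> \<nu> i"
  proof (rule eigenvalue_nonneg[OF V(1) _ i])
    fix x :: "complex vec" assume "x \<in> carrier_vec n"
    then show "0 \<le> qf (V * real_diag n \<nu> * adj V) x"
      using gram_hermitian(3)[of "adj B" n n x] B unfolding V(2)[symmetric] by simp
  qed
  with True show ?thesis by simp
next
  case False
  note W' = unitaryD[OF W(1)]
  show ?thesis
  proof (rule min_max_bound[OF V(1) V(3) i])
    show "B * W \<in> carrier_mat n n" using B W' by simp
    fix c :: "complex vec"
    assume c: "c \<in> carrier_vec n" "c \<noteq> 0\<^sub>v n" and supp: "\<And>j. i < j \<Longrightarrow> j < n \<Longrightarrow> c $ j = 0"
    have BWc: "B * W *\<^sub>v c = B *\<^sub>v (W *\<^sub>v c)" using B W' c by (simp add: mat_vec_assoc)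
    have ge: "b i * a * (cmod (c $ j))\<^sup>2 \<le> b j * a * (cmod (c $ j))\<^sup>2" if "j < n" "0 \<le> a" for a j
    proof (cases "i < j")
      case False
      then have "b i \<le> b j" using W(3)[of j i] i by simp
      then show ?thesis using that(2) by (intro mult_right_mono) auto
    qed (simp add: supp that)
    have nsq: "nsq (B * W *\<^sub>v c) = (\<Sum>j<n. b j * (cmod (c $ j))\<^sup>2)"
      unfolding BWc using B W' c by (subst nsq_mult[of _ n n]) (auto simp: W(2) qf_spectral_apply[OF W(1)])
    have "b i * nsq c \<le> nsq (B * W *\<^sub>v c)"
      unfolding nsq unfolding nsq_sum[OF c(1)] sum_distrib_left using ge[of _ 1] by (intro sum_mono) auto
    moreover have "0 < b i * nsq c" using False nsq_pos[OF c] by simp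
    ultimately have pos: "0 < nsq (B * W *\<^sub>v c)" by linarith
    have "adj B *\<^sub>v (B * W *\<^sub>v c) = (adj B * B) *\<^sub>v (W *\<^sub>v c)"
      using B W' c by (simp add: mat_vec_assoc)
    also have "\<dots> = W *\<^sub>v (real_diag n b *\<^sub>v (adj W *\<^sub>v (W *\<^sub>v c)))"
      unfolding W(2) using W' c by (simp add: mat_vec_assoc)
    also have "\<dots> = W *\<^sub>v (real_diag n b *\<^sub>v c)"
      by (simp add: unitary_cancel_vec[OF W(1) c(1)])
    finally have "nsq (adj B *\<^sub>v (B * W *\<^sub>v c)) = nsq (real_diag n b *\<^sub>v c)"
      using nsq_isometry[OF W(1), of "real_diag n b *\<^sub>v c"] by simp
    also have "\<dots> = (\<Sum>j<n. b j * b j * (cmod (c $ j))\<^sup>2)"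
    proof -
      have "(cmod (complex_of_real (b j) * c $ j))\<^sup>2 = b j * b j * (cmod (c $ j))\<^sup>2" for j
        by (simp add: norm_mult power_mult_distrib power2_eq_square)
      then have "(cmod ((real_diag n b *\<^sub>v c) $ j))\<^sup>2 = b j * b j * (cmod (c $ j))\<^sup>2" if "j < n" for j
        using real_diag_mult_vec[OF c(1) that, of b] by simp
      then show ?thesis by (subst nsq_sum[of _ n]) (simp_all del: index_mult_mat_vec)
    qed
    finally have "qf (B * adj B) (B * W *\<^sub>v c) = (\<Sum>j<n. b j * b j * (cmod (c $ j))\<^sup>2)"
      using nsq_mult[of "adj B" n n "B * W *\<^sub>v c"] B W' by simp
    moreover have "b i * nsq (B * W *\<^sub>v c) \<le> (\<Sum>j<n. b j * b j * (cmod (c $ j))\<^sup>2)"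
      unfolding nsq sum_distrib_left
    proof (intro sum_mono)
      fix j assume "j \<in> {..<n}"
      then show "b i * (b j * (cmod (c $ j))\<^sup>2) \<le> b j * b j * (cmod (c $ j))\<^sup>2"
      proof (cases "i < j")
        case False
        then have "0 \<le> b j" using W(3)[of j i] i \<open>\<not> b i \<le> 0\<close> by simp
        then show ?thesis using ge[of j "b j"] \<open>j \<in> {..<n}\<close> by (simp add: mult.assoc)
      qed (use supp \<open>j \<in> {..<n}\<close> in simp)
    qed
    ultimately show "0 < nsq (B * W *\<^sub>v c) \<and>
        b i * nsq (B * W *\<^sub>v c) \<le> qf (V * real_diag n \<nu> * adj V) (B * W *\<^sub>v c)"
      unfolding V(2)[symmetric] using pos by simp
  qed
qed

text \<open>Applying the eigenvalue comparison to \<open>B\<close> and to \<open>B\<^sup>*\<close> gives equal sorted spectra. This yields the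
  unitary equivalence without constructing a polar decomposition.\<close>
lemma gram_unitarily_equivalent:
  assumes B: "B \<in> carrier_mat n n"
  shows "\<exists>U. unitary_mat n U \<and> B * adj B = U * (adj B * B) * adj U"
proof -
  have Ba: "adj B \<in> carrier_mat n n" using B by simp
  note G = gram_hermitian[OF B] and G' = gram_hermitian[OF Ba, unfolded adj_adj]
  obtain W b where W: "unitary_mat n W" "adj B * B = W * real_diag n b * adj W" "\<And>i j. i \<le> j \<Longrightarrow> j < n \<Longrightarrow> b j \<le> b i"
    using hermitian_spectral_sorted[OF G(1,2), of "\<lambda>t. t"] by blast
  obtain V \<nu> where V: "unitary_mat n V" "B * adj B = V * real_diag n \<nu> * adj V" "\<And>i j. i \<le> j \<Longrightarrow> j < n \<Longrightarrow> \<nu> j \<le> \<nu> i"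
    using hermitian_spectral_sorted[OF G'(1,2), of "\<lambda>t. t"] by blast
  have "b i = \<nu> i" if "i < n" for i
    using gram_eigenvalues_le[OF B W V that]
      gram_eigenvalues_le[of "adj B" n V \<nu> W b, unfolded adj_adj, OF Ba V W that] by (rule antisym)
  then have d: "real_diag n b = real_diag n \<nu>"
    by (intro eq_matI) (auto simp: mat_diag_def)
  note V' = unitaryD[OF V(1)] and W' = unitaryD[OF W(1)]
  show ?thesis
  proof (intro exI conjI)
    show "unitary_mat n (V * adj W)" by (rule isometry_mult[OF V(1) unitary_adj[OF W(1)]])
    show "B * adj B = V * adj W * (adj B * B) * adj (V * adj W)"
      unfolding V(2) W(2) d
      using V' W' by (simp add: adj_mult mat_assoc isometry_cancel[OF W(1)])
  qed
qed

section \<open>Convex monotone functions of compressions\<close>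

text \<open>The mass missing from the weights is placed at the point \<open>0\<close>, where \<open>g\<close> vanishes.\<close>
lemma jensen_subprobability:
  fixes p l :: "nat \<Rightarrow> real"
  assumes conv: "convex_on {0..} g" and g0: "g 0 = 0"
    and p: "\<And>k. k < n \<Longrightarrow> 0 \<le> p k" "(\<Sum>k<n. p k) \<le> 1" and l: "\<And>k. k < n \<Longrightarrow> 0 \<le> l k"
  shows "g (\<Sum>k<n. p k * l k) \<le> (\<Sum>k<n. p k * g (l k))"
proof -
  \<comment> \<open>The index \<open>n\<close> carries the extra point \<open>0\<close>.\<close>
  define p' where "p' = (\<lambda>k. if k < n then p k else 1 - (\<Sum>k<n. p k))"
  define l' where "l' = (\<lambda>k. if k < n then l k else 0)"
  have "g (\<Sum>k\<in>{..n}. p' k *\<^sub>R l' k) \<le> (\<Sum>k\<in>{..n}. p' k * g (l' k))"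
    by (rule convex_on_sum[OF _ _ conv])
      (use p l in \<open>auto simp: p'_def l'_def lessThan_Suc_atMost[symmetric]\<close>)
  then show ?thesis
    by (simp add: p'_def l'_def g0 lessThan_Suc_atMost[symmetric])
qed

text \<open>A superlevel set of a monotone function is an interval.\<close>
lemma monotone_on_average_ge:
  fixes w m :: "nat \<Rightarrow> real"
  assumes mono: "mono_on {0..} g \<or> antimono_on {0..} g" and S: "finite S"
    and w: "\<And>j. j \<in> S \<Longrightarrow> 0 \<le> w j" "(\<Sum>j\<in>S. w j) = 1"
    and m: "\<And>j. j \<in> S \<Longrightarrow> 0 \<le> m j" "\<And>j. j \<in> S \<Longrightarrow> t \<le> (g (m j) :: real)"
  shows "t \<le> g (\<Sum>j\<in>S. w j * m j)"
proof -
  have "convex {z. 0 \<le> z \<and> t \<le> g z}"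
  proof (rule convexI)
    fix x y u v :: real
    assume x: "x \<in> {z. 0 \<le> z \<and> t \<le> g z}" and y: "y \<in> {z. 0 \<le> z \<and> t \<le> g z}"
      and uv: "0 \<le> u" "0 \<le> v" "u + v = 1"
    have hi: "u * x + v * y \<le> max x y" by (rule convex_bound_le) (use uv in auto)
    have "u * (- x) + v * (- y) \<le> max (- x) (- y)" by (rule convex_bound_le) (use uv in auto)
    moreover have "max (- x) (- y) = - min x y" by (simp add: minus_min_eq_max)
    ultimately have lo: "min x y \<le> u * x + v * y" by simp
    have nonneg: "0 \<le> u * x + v * y" using x y uv by simp
    have "t \<le> g (u * x + v * y)"
      using mono
    proof
      assume "mono_on {0..} g"
      then have "g (min x y) \<le> g (u * x + v * y)"
        using lo x y nonneg by (intro mono_onD[of "{0..}" g]) auto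
      then show ?thesis using x y by (auto simp: min_def split: if_splits)
    next
      assume "antimono_on {0..} g"
      then have "g (max x y) \<le> g (u * x + v * y)"
        using hi x y nonneg by (intro monotone_onD[of "{0..}" "(\<le>)" "(\<ge>)" g]) auto
      then show ?thesis using x y by (auto simp: max_def split: if_splits)
    qed
    then show "u *\<^sub>R x + v *\<^sub>R y \<in> {z. 0 \<le> z \<and> t \<le> g z}" using nonneg by simp
  qed
  from convex_sum[OF S this w(2) w(1), of m] m show ?thesis by simp
qed

text \<open>Let \<open>M = Y H Y\<^sup>*\<close> with eigenvalues \<open>m j\<close> sorted so that \<open>g (m j)\<close> decreases. For a unit vector
  \<open>x\<close> in the span of the first \<open>i + 1\<close> eigenvectors, the number \<open>qf M x\<close> is an average of
  \<open>m 0, \<dots>, m i\<close>, whence \<open>g (qf M x) \<ge> g (m i)\<close>. It is also the sum of the eigenvalues of \<open>H\<close> with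
  the spectral weights of \<open>Y\<^sup>* x\<close>, of total mass at most \<open>1\<close>, so Jensen's inequality bounds \<open>g (qf M x)\<close>
  by \<open>qf (Y g(H) Y\<^sup>*) x\<close>. The min-max principle then bounds the eigenvalues of \<open>Y g(H) Y\<^sup>*\<close> below by
  the \<open>g (m i)\<close>.\<close>
lemma compression_orbit_le:
  assumes H: "H \<in> carrier_mat n n" "hermitian_mat H" and psd: "\<And>x. x \<in> carrier_vec n \<Longrightarrow> 0 \<le> qf H x"
    and Y: "Y \<in> carrier_mat n n" and contr: "\<And>x. x \<in> carrier_vec n \<Longrightarrow> nsq (adj Y *\<^sub>v x) \<le> nsq x"
    and mono: "mono_on {0..} g \<or> antimono_on {0..} g" and conv: "convex_on {0..} g" and g0: "g 0 = 0"
  shows "\<exists>U. unitary_mat n U \<and> (\<forall>x\<in>carrier_vec n.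
    qf (mat_fun g (Y * H * adj Y)) (adj U *\<^sub>v x) \<le> qf (Y * mat_fun g H * adj Y) x)"
proof -
  obtain L l where L: "unitary_mat n L" and Hl: "H = L * real_diag n l * adj L"
    using hermitian_spectral[OF H] .
  note L' = unitaryD[OF L]
  have l: "0 \<le> l k" if "k < n" for k
    using eigenvalue_nonneg[OF L _ that] psd unfolding Hl by blast
  define M N where "M = Y * H * adj Y" and "N = Y * mat_fun g H * adj Y"
  have M: "M \<in> carrier_mat n n" "hermitian_mat M"
    using Y H by (auto simp: M_def hermitian_conj)
  have N: "N \<in> carrier_mat n n" "hermitian_mat N"
    using Y mat_fun_carrier[OF H, of g] hermitian_conj[of "mat_fun g H" n Y n] by (auto simp: N_def)
  obtain W m where W: "unitary_mat n W" and Mm: "M = W * real_diag n m * adj W"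
    and m: "\<And>i j. i \<le> j \<Longrightarrow> j < n \<Longrightarrow> g (m j) \<le> g (m i)"
    using hermitian_spectral_sorted[OF M, of g] by blast
  obtain V \<nu> where V: "unitary_mat n V" and N\<nu>: "N = V * real_diag n \<nu> * adj V"
    and \<nu>: "\<And>i j. i \<le> j \<Longrightarrow> j < n \<Longrightarrow> \<nu> j \<le> \<nu> i"
    using hermitian_spectral_sorted[OF N, of "\<lambda>t. t"] by blast
  note W' = unitaryD[OF W]
  have m0: "0 \<le> m j" if "j < n" for j
  proof (rule eigenvalue_nonneg[OF W _ that])
    fix x :: "complex vec" assume "x \<in> carrier_vec n"
    then show "0 \<le> qf (W * real_diag n m * adj W) x"
      unfolding Mm[symmetric] M_def using Y H psd by (subst qf_conj[of _ n]) auto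
  qed
  have "g (m i) \<le> \<nu> i" if i: "i < n" for i
  proof (rule min_max_bound[OF V \<nu> i W'(1)])
    fix c :: "complex vec"
    assume c: "c \<in> carrier_vec n" "c \<noteq> 0\<^sub>v n" and supp: "\<And>j. i < j \<Longrightarrow> j < n \<Longrightarrow> c $ j = 0"
    define s where "s = nsq c"
    define x where "x = W *\<^sub>v c"
    define y where "y = adj Y *\<^sub>v x"
    define z where "z = adj L *\<^sub>v y"
    have s: "0 < s" using nsq_pos[OF c] by (simp add: s_def)
    have x: "x \<in> carrier_vec n" "nsq x = s"
      using W' nsq_isometry[OF W c(1)] by (auto simp: x_def s_def)
    have y: "y \<in> carrier_vec n" "nsq y \<le> s"
      using Y contr[OF x(1)] x(2) by (auto simp: y_def)
    have z: "z \<in> carrier_vec n" "nsq z \<le> s"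
      using L' nsq_unitary_adj[OF L y(1)] y(2) by (auto simp: z_def)
    \<comment> \<open>\<open>p\<close> holds the spectral weights of \<open>y\<close> for \<open>H\<close>, of mass at most \<open>1\<close>, and \<open>w\<close> those of \<open>x\<close> for \<open>M\<close>,
      of mass exactly \<open>1\<close> because \<open>Y H Y\<^sup>*\<close> is diagonalised by a unitary.\<close>
    define p where "p = (\<lambda>k. (cmod (z $ k))\<^sup>2 / s)"
    define w where "w = (\<lambda>j. (cmod (c $ j))\<^sup>2 / s)"
    have csum: "(\<Sum>j\<le>i. h j * (cmod (c $ j))\<^sup>2) = (\<Sum>j<n. h j * (cmod (c $ j))\<^sup>2)" for h
      by (rule sum.mono_neutral_left) (use i supp in auto)
    have "(\<Sum>j\<le>i. w j) = (\<Sum>j\<le>i. 1 * (cmod (c $ j))\<^sup>2) / s" by (simp add: w_def sum_divide_distrib)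
    also have "\<dots> = 1" unfolding csum using s by (simp add: s_def nsq_sum[OF c(1)])
    finally have wsum: "(\<Sum>j\<le>i. w j) = 1" .
    have "qf M x = (\<Sum>j<n. m j * (cmod (c $ j))\<^sup>2)"
      unfolding Mm x_def by (rule qf_spectral_apply[OF W c(1)])
    also have "\<dots> = s * (\<Sum>j\<le>i. w j * m j)"
      unfolding csum[symmetric] sum_distrib_left using s by (intro sum.cong) (auto simp: w_def)
    finally have 1: "qf M x = s * (\<Sum>j\<le>i. w j * m j)" .
    have "qf M x = qf H y"
      unfolding M_def y_def by (rule qf_conj[OF H(1) Y x(1)])
    also have "\<dots> = (\<Sum>k<n. l k * (cmod (z $ k))\<^sup>2)"
      unfolding Hl z_def by (rule qf_spectral[OF L'(1) y(1)])
    also have "\<dots> = s * (\<Sum>k<n. p k * l k)"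
      unfolding sum_distrib_left using s by (intro sum.cong) (auto simp: p_def)
    finally have 2: "(\<Sum>j\<le>i. w j * m j) = (\<Sum>k<n. p k * l k)"
      using 1 s by simp
    have "qf N x = qf (mat_fun g H) y"
      unfolding N_def y_def by (rule qf_conj[OF mat_fun_carrier(1)[OF H] Y x(1)])
    also have "\<dots> = (\<Sum>k<n. g (l k) * (cmod (z $ k))\<^sup>2)"
      unfolding Hl mat_fun_spectral[OF L] z_def by (rule qf_spectral[OF L'(1) y(1)])
    also have "\<dots> = s * (\<Sum>k<n. p k * g (l k))"
      unfolding sum_distrib_left using s by (intro sum.cong) (auto simp: p_def)
    finally have 3: "qf N x = s * (\<Sum>k<n. p k * g (l k))" .
    have "g (m i) \<le> g (\<Sum>j\<le>i. w j * m j)"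
      by (rule monotone_on_average_ge[OF mono _ _ wsum]) (use s i m0 m in \<open>auto simp: w_def\<close>)
    also have "\<dots> \<le> (\<Sum>k<n. p k * g (l k))"
      unfolding 2
    proof (rule jensen_subprobability[OF conv g0 _ _ l])
      show "(\<Sum>k<n. p k) \<le> 1"
        using z(2) s by (simp add: p_def sum_divide_distrib[symmetric] nsq_sum[OF z(1), symmetric])
    qed (use s in \<open>auto simp: p_def\<close>)
    finally have "s * g (m i) \<le> qf N x" unfolding 3 using s by simp
    then show "0 < nsq (W *\<^sub>v c) \<and> g (m i) * nsq (W *\<^sub>v c) \<le> qf (V * real_diag n \<nu> * adj V) (W *\<^sub>v c)"
      unfolding N\<nu>[symmetric] x_def[symmetric] using x(2) s by (simp add: mult.commute)
  qed
  from eigenvalue_order_imp_orbit_le[where b = "\<lambda>i. g (m i)" and \<nu> = \<nu>, OF V W this] show ?thesis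
    unfolding M_def[symmetric] N_def[symmetric] unfolding Mm N\<nu> mat_fun_spectral[OF W] by blast
qed

section \<open>Superadditivity under pinchings\<close>

text \<open>The Loewner inequality \<open>\<Sum> U\<^sub>k M\<^sub>k U\<^sub>k\<^sup>* \<le> N\<close> for suitable unitaries \<open>U\<^sub>k\<close>, stated through
  quadratic forms.\<close>
definition orbit_sum_le :: "nat \<Rightarrow> 'k set \<Rightarrow> ('k \<Rightarrow> complex mat) \<Rightarrow> complex mat \<Rightarrow> bool" where
  "orbit_sum_le n K M N \<longleftrightarrow> (\<exists>U. (\<forall>k\<in>K. unitary_mat n (U k)) \<and>
     (\<forall>x\<in>carrier_vec n. (\<Sum>k\<in>K. qf (M k) (adj (U k) *\<^sub>v x)) \<le> qf N x))"

text \<open>The sign makes \<open>s g(H)\<close> positive semidefinite, so that it has a square root.\<close>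
lemma monotone_sign:
  assumes "mono_on {0..} g \<or> antimono_on {0..} g" "g 0 = (0::real)"
  obtains s :: real where "s = 1 \<or> s = -1" "\<And>t. (0::real) \<le> t \<Longrightarrow> 0 \<le> s * g t"
  using assms(1)
proof
  assume "mono_on {0..} g"
  then have "0 \<le> 1 * g t" if "0 \<le> t" for t
    using that assms(2) mono_onD[of "{0..}" g 0 t] by simp
  then show ?thesis using that by blast
next
  assume "antimono_on {0..} g"
  then have "0 \<le> -1 * g t" if "0 \<le> t" for t
    using that assms(2) monotone_onD[of "{0..}" "(\<le>)" "(\<ge>)" g 0 t] by simp
  then show ?thesis using that by blast
qed

text \<open>With \<open>G = g(H)\<close> of constant sign \<open>s\<close> and \<open>R = (s G)\<^bsup>1/2\<^esup>\<close>, the resolution of the identity gives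
  \<open>qf G x = s nsq (R x) = \<Sum> s nsq (Y\<^sub>k R x)\<close>. For \<open>T = R Y\<^sub>k\<close> the \<open>k\<close>-th term is \<open>s\<close> times the form of
  \<open>T T\<^sup>*\<close>, which is unitarily equivalent to \<open>T\<^sup>* T = s Y\<^sub>k G Y\<^sub>k\<close>, and \<open>Y\<^sub>k G Y\<^sub>k\<close> dominates
  \<open>g(Y\<^sub>k H Y\<^sub>k)\<close> up to a unitary.\<close>
lemma pinching_superadditive:
  assumes H: "H \<in> carrier_mat n n" "hermitian_mat H" and psd: "\<And>x. x \<in> carrier_vec n \<Longrightarrow> 0 \<le> qf H x"
    and K: "finite K" and Y: "\<And>k. k \<in> K \<Longrightarrow> Y k \<in> carrier_mat n n" "\<And>k. k \<in> K \<Longrightarrow> hermitian_mat (Y k)"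
    and resolution: "\<And>x. x \<in> carrier_vec n \<Longrightarrow> (\<Sum>k\<in>K. nsq (Y k *\<^sub>v x)) = nsq x"
    and mono: "mono_on {0..} g \<or> antimono_on {0..} g" and conv: "convex_on {0..} g" and g0: "g 0 = 0"
  shows "orbit_sum_le n K (\<lambda>k. mat_fun g (Y k * H * Y k)) (mat_fun g H)"
proof -
  obtain s where s: "s = 1 \<or> s = -1" and sg: "\<And>t. 0 \<le> t \<Longrightarrow> 0 \<le> s * g t"
    using monotone_sign[OF mono g0] by blast
  have ss: "s * s = 1" using s by auto
  obtain L l where L: "unitary_mat n L" and Hl: "H = L * real_diag n l * adj L"
    using hermitian_spectral[OF H] .
  note L' = unitaryD[OF L]
  have l: "0 \<le> l k" if "k < n" for k
    using eigenvalue_nonneg[OF L _ that] psd unfolding Hl by blast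
  \<comment> \<open>\<open>R\<close> is the positive square root of \<open>s g(H)\<close>.\<close>
  define R where "R = L * real_diag n (\<lambda>i. sqrt (s * g (l i))) * adj L"
  have R: "R \<in> carrier_mat n n" using L' by (simp add: R_def)
  have adjR: "adj R = R" using L' by (simp add: R_def adj_mult mat_assoc)
  define G where "G = mat_fun g H"
  have G: "G \<in> carrier_mat n n" using mat_fun_carrier[OF H] by (simp add: G_def)
  have RR: "R * R = complex_of_real s \<cdot>\<^sub>m G"
  proof -
    have "R * R = L * (real_diag n (\<lambda>i. sqrt (s * g (l i))) * real_diag n (\<lambda>i. sqrt (s * g (l i)))) * adj L"
      using L' by (simp add: R_def mat_assoc isometry_cancel[OF L] del: mat_diag_diag)
    also have "real_diag n (\<lambda>i. sqrt (s * g (l i))) * real_diag n (\<lambda>i. sqrt (s * g (l i)))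
        = complex_of_real s \<cdot>\<^sub>m real_diag n (\<lambda>i. g (l i))"
    proof (rule eq_matI)
      fix i j assume "i < dim_row (complex_of_real s \<cdot>\<^sub>m real_diag n (\<lambda>i. g (l i)))"
        "j < dim_col (complex_of_real s \<cdot>\<^sub>m real_diag n (\<lambda>i. g (l i)))"
      moreover from this have "sqrt (s * g (l j)) * sqrt (s * g (l j)) = s * g (l j)"
        using sg l by simp
      ultimately show "(real_diag n (\<lambda>i. sqrt (s * g (l i))) * real_diag n (\<lambda>i. sqrt (s * g (l i)))) $$ (i, j)
        = (complex_of_real s \<cdot>\<^sub>m real_diag n (\<lambda>i. g (l i))) $$ (i, j)"
        unfolding mat_diag_diag of_real_mult[symmetric] by (simp add: mat_diag_def)
    qed auto
    finally show ?thesis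
      using L' unfolding G_def Hl mat_fun_spectral[OF L]
      by (simp add: mult_smult_assoc_mat[of _ n n _ n] mult_smult_distrib[of _ n n _ n])
  qed
  have qfRR: "qf (R * R) x = s * qf G x" if "x \<in> carrier_vec n" for x
  proof -
    have "(complex_of_real s \<cdot>\<^sub>m G) *\<^sub>v x = complex_of_real s \<cdot>\<^sub>v (G *\<^sub>v x)"
      using that G by (intro eq_vecI) auto
    then show ?thesis using that G unfolding RR qf_def by simp
  qed
  have adjY: "adj (Y k) = Y k" if "k \<in> K" for k using Y(2)[OF that] by (simp add: hermitian_mat_def)
  have term_bound: "\<exists>U. unitary_mat n U \<and> (\<forall>x\<in>carrier_vec n.
      qf (mat_fun g (Y k * H * Y k)) (adj U *\<^sub>v x) \<le> s * nsq (Y k *\<^sub>v (R *\<^sub>v x)))" if k: "k \<in> K" for k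
  proof -
    note Yk = Y(1)[OF k]
    have contr: "nsq (adj (Y k) *\<^sub>v x) \<le> nsq x" if "x \<in> carrier_vec n" for x
    proof -
      have "nsq (Y k *\<^sub>v x) \<le> (\<Sum>k\<in>K. nsq (Y k *\<^sub>v x))"
        by (rule member_le_sum[OF k _ K]) (rule nsq_nonneg[OF mult_mat_vec_carrier[OF Y(1) that]], simp)
      then show ?thesis using resolution[OF that] by (simp add: adjY[OF k])
    qed
    obtain W where W: "unitary_mat n W" and Wle: "\<And>x. x \<in> carrier_vec n \<Longrightarrow>
        qf (mat_fun g (Y k * H * Y k)) (adj W *\<^sub>v x) \<le> qf (Y k * G * Y k) x"
      using compression_orbit_le[OF H psd Yk contr mono conv g0]
      unfolding G_def adjY[OF k] by blast
    define T where "T = R * Y k"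
    have T: "T \<in> carrier_mat n n" using R Yk by (simp add: T_def)
    have adjT: "adj T = Y k * R" using R Yk adjR adjY[OF k] by (simp add: T_def adj_mult)
    obtain U where U: "unitary_mat n U" and TT: "T * adj T = U * (adj T * T) * adj U"
      using gram_unitarily_equivalent[OF T] by blast
    note U' = unitaryD[OF U]
    show ?thesis
    proof (intro exI conjI ballI)
      show "unitary_mat n (U * W)" by (rule isometry_mult[OF U W])
      fix x :: "complex vec" assume x: "x \<in> carrier_vec n"
      have "adj (U * W) *\<^sub>v x = adj W *\<^sub>v (adj U *\<^sub>v x)"
        using U' unitaryD[OF W] x by (simp add: adj_mult mat_vec_assoc)
      then have "qf (mat_fun g (Y k * H * Y k)) (adj (U * W) *\<^sub>v x) \<le> qf (Y k * G * Y k) (adj U *\<^sub>v x)"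
        using Wle[of "adj U *\<^sub>v x"] U' by simp
      also have "\<dots> = qf G (Y k *\<^sub>v (adj U *\<^sub>v x))"
        using qf_conj[OF G Yk, of "adj U *\<^sub>v x"] U' by (simp add: adjY[OF k])
      also have "\<dots> = s * qf (R * R) (Y k *\<^sub>v (adj U *\<^sub>v x))"
        using Yk ss by (subst qfRR) (simp_all add: mult.assoc[symmetric])
      also have "qf (R * R) (Y k *\<^sub>v (adj U *\<^sub>v x)) = nsq (T *\<^sub>v (adj U *\<^sub>v x))"
        using nsq_mult[OF R, of "Y k *\<^sub>v (adj U *\<^sub>v x)"] R Yk U' x
        by (simp add: adjR T_def mat_vec_assoc)
      also have "\<dots> = qf (adj T * T) (adj U *\<^sub>v x)"
        using U' by (intro nsq_mult[OF T]) simp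
      also have "\<dots> = qf (T * adj T) x"
        unfolding TT using T by (intro qf_conj[OF _ U'(1) x, symmetric]) simp
      also have "\<dots> = nsq (adj T *\<^sub>v x)"
        using nsq_mult[of "adj T" n n x] T x by simp
      also have "\<dots> = nsq (Y k *\<^sub>v (R *\<^sub>v x))"
        unfolding adjT using R Yk x by (simp add: mat_vec_assoc)
      finally show "qf (mat_fun g (Y k * H * Y k)) (adj (U * W) *\<^sub>v x) \<le> s * nsq (Y k *\<^sub>v (R *\<^sub>v x))" .
    qed
  qed
  then obtain U where U: "\<And>k. k \<in> K \<Longrightarrow> unitary_mat n (U k)"
    and le: "\<And>k x. k \<in> K \<Longrightarrow> x \<in> carrier_vec n \<Longrightarrow>
      qf (mat_fun g (Y k * H * Y k)) (adj (U k) *\<^sub>v x) \<le> s * nsq (Y k *\<^sub>v (R *\<^sub>v x))"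
    by metis
  have "(\<Sum>k\<in>K. qf (mat_fun g (Y k * H * Y k)) (adj (U k) *\<^sub>v x)) \<le> qf (mat_fun g H) x"
    if x: "x \<in> carrier_vec n" for x
  proof -
    have "(\<Sum>k\<in>K. qf (mat_fun g (Y k * H * Y k)) (adj (U k) *\<^sub>v x)) \<le> (\<Sum>k\<in>K. s * nsq (Y k *\<^sub>v (R *\<^sub>v x)))"
      using le x by (intro sum_mono) auto
    also have "\<dots> = s * nsq (R *\<^sub>v x)"
      using R by (simp add: sum_distrib_left[symmetric] resolution)
    also have "\<dots> = s * qf (R * R) x"
      using nsq_mult[OF R x] by (simp add: adjR)
    also have "\<dots> = qf G x" using qfRR[OF x] ss by (simp add: mult.assoc[symmetric])
    finally show ?thesis by (simp add: G_def)
  qed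
  with U show ?thesis unfolding orbit_sum_le_def by blast
qed

lemma orbit_sum_le_cong:
  assumes "orbit_sum_le n K M N" "\<And>k. k \<in> K \<Longrightarrow> M k = M' k"
  shows "orbit_sum_le n K M' N"
proof -
  have "(\<Sum>k\<in>K. qf (M k) (adj (U k) *\<^sub>v x)) = (\<Sum>k\<in>K. qf (M' k) (adj (U k) *\<^sub>v x))" for U x
    using assms(2) by (intro sum.cong) auto
  then show ?thesis using assms(1) unfolding orbit_sum_le_def by simp
qed

text \<open>The index sets of the inner inequalities are the fibres of \<open>f\<close>: a strip is indexed by its common
  column (or row) set, and \<open>f\<close> sends a block to its strip.\<close>
lemma orbit_sum_le_trans:
  assumes fin: "finite K" and le: "orbit_sum_le n (f ` K) M N"
    and le': "\<And>S. S \<in> f ` K \<Longrightarrow> orbit_sum_le n {k \<in> K. f k = S} M' (M S)"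
  shows "orbit_sum_le n K M' N"
proof -
  obtain U where U: "\<And>S. S \<in> f ` K \<Longrightarrow> unitary_mat n (U S)"
    and Ule: "\<And>x. x \<in> carrier_vec n \<Longrightarrow> (\<Sum>S\<in>f ` K. qf (M S) (adj (U S) *\<^sub>v x)) \<le> qf N x"
    using le unfolding orbit_sum_le_def by blast
  have "\<forall>S\<in>f ` K. \<exists>W. (\<forall>k\<in>{k \<in> K. f k = S}. unitary_mat n (W k)) \<and>
      (\<forall>x\<in>carrier_vec n. (\<Sum>k | k \<in> K \<and> f k = S. qf (M' k) (adj (W k) *\<^sub>v x)) \<le> qf (M S) x)"
    using le' unfolding orbit_sum_le_def by blast
  from bchoice[OF this] obtain W where
    WW: "\<forall>S\<in>f ` K. (\<forall>k\<in>{k \<in> K. f k = S}. unitary_mat n (W S k)) \<and>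
      (\<forall>x\<in>carrier_vec n. (\<Sum>k | k \<in> K \<and> f k = S. qf (M' k) (adj (W S k) *\<^sub>v x)) \<le> qf (M S) x)" ..
  have W: "unitary_mat n (W (f k) k)" if "k \<in> K" for k
    using bspec[OF WW, of "f k"] that by simp
  have Wle: "(\<Sum>k | k \<in> K \<and> f k = S. qf (M' k) (adj (W S k) *\<^sub>v x)) \<le> qf (M S) x"
    if "S \<in> f ` K" "x \<in> carrier_vec n" for S x
    using bspec[OF WW that(1)] that(2) by (elim conjE) (rule bspec)
  define V where "V = (\<lambda>k. U (f k) * W (f k) k)"
  have "unitary_mat n (V k)" if "k \<in> K" for k
    unfolding V_def by (rule isometry_mult[OF U W]) (use that in auto)
  moreover have "(\<Sum>k\<in>K. qf (M' k) (adj (V k) *\<^sub>v x)) \<le> qf N x" if x: "x \<in> carrier_vec n" for x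
  proof -
    have adjV: "adj (V k) *\<^sub>v x = adj (W (f k) k) *\<^sub>v (adj (U (f k)) *\<^sub>v x)" if "k \<in> K" for k
    proof -
      have "U (f k) \<in> carrier_mat n n" "W (f k) k \<in> carrier_mat n n"
        using isometryD(1)[OF U, of "f k"] isometryD(1)[OF W[OF that]] that by auto
      then show ?thesis using x unfolding V_def by (simp add: adj_mult mat_vec_assoc)
    qed
    have "(\<Sum>k\<in>K. qf (M' k) (adj (V k) *\<^sub>v x)) =
        (\<Sum>S\<in>f ` K. \<Sum>k | k \<in> K \<and> f k = S. qf (M' k) (adj (V k) *\<^sub>v x))"
      by (rule sum.image_gen[OF fin])
    also have "\<dots> = (\<Sum>S\<in>f ` K. \<Sum>k | k \<in> K \<and> f k = S. qf (M' k) (adj (W S k) *\<^sub>v (adj (U S) *\<^sub>v x)))"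
      by (intro sum.cong refl) (auto simp: adjV)
    also have "\<dots> \<le> (\<Sum>S\<in>f ` K. qf (M S) (adj (U S) *\<^sub>v x))"
    proof (intro sum_mono Wle)
      fix S assume "S \<in> f ` K"
      from isometryD(1)[OF U[OF this]] show "adj (U S) *\<^sub>v x \<in> carrier_vec n" by simp
    qed
    also have "\<dots> \<le> qf N x" by (rule Ule[OF x])
    finally show ?thesis .
  qed
  ultimately show ?thesis unfolding orbit_sum_le_def by blast
qed

text \<open>The relation sees its matrices only up to unitary equivalence, so Gram matrices \<open>C C\<^sup>*\<close> may be
  traded for \<open>C\<^sup>* C\<close> on both sides.\<close>
lemma orbit_sum_le_unitary_conj:
  assumes le: "orbit_sum_le n K M N" and N: "N \<in> carrier_mat n n"
    and M': "\<And>k. k \<in> K \<Longrightarrow> M' k \<in> carrier_mat n n"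
    and W: "unitary_mat n W"
    and eq: "\<And>k. k \<in> K \<Longrightarrow> \<exists>V. unitary_mat n V \<and> M k = V * M' k * adj V"
  shows "orbit_sum_le n K M' (W * N * adj W)"
proof -
  obtain U where U: "\<And>k. k \<in> K \<Longrightarrow> unitary_mat n (U k)"
    and Ule: "\<And>x. x \<in> carrier_vec n \<Longrightarrow> (\<Sum>k\<in>K. qf (M k) (adj (U k) *\<^sub>v x)) \<le> qf N x"
    using le unfolding orbit_sum_le_def by blast
  obtain V where V: "\<And>k. k \<in> K \<Longrightarrow> unitary_mat n (V k)" "\<And>k. k \<in> K \<Longrightarrow> M k = V k * M' k * adj (V k)"
    using eq by metis
  note W' = unitaryD[OF W]
  show ?thesis
    unfolding orbit_sum_le_def
  proof (intro exI conjI ballI)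
    show "unitary_mat n (W * U k * V k)" if "k \<in> K" for k
      by (rule isometry_mult[OF isometry_mult[OF W U[OF that]] V(1)[OF that]])
    fix x :: "complex vec" assume x: "x \<in> carrier_vec n"
    have "qf (M' k) (adj (W * U k * V k) *\<^sub>v x) = qf (M k) (adj (U k) *\<^sub>v (adj W *\<^sub>v x))" if k: "k \<in> K" for k
    proof -
      note Uk = isometryD(1)[OF U[OF k]] and Vk = isometryD(1)[OF V(1)[OF k]]
      have "adj (W * U k * V k) *\<^sub>v x = adj (V k) *\<^sub>v (adj (U k) *\<^sub>v (adj W *\<^sub>v x))"
        using W'(1) Uk Vk x by (simp add: adj_mult mat_vec_assoc)
      then show ?thesis
        unfolding V(2)[OF k] using qf_conj[OF M'[OF k] Vk, of "adj (U k) *\<^sub>v (adj W *\<^sub>v x)"] Uk by simp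
    qed
    then have "(\<Sum>k\<in>K. qf (M' k) (adj (W * U k * V k) *\<^sub>v x)) = (\<Sum>k\<in>K. qf (M k) (adj (U k) *\<^sub>v (adj W *\<^sub>v x)))"
      by (intro sum.cong) auto
    also have "\<dots> \<le> qf N (adj W *\<^sub>v x)" using W'(1) by (intro Ule) simp
    also have "\<dots> = qf (W * N * adj W) x" by (rule qf_conj[OF N W'(1) x, symmetric])
    finally show "(\<Sum>k\<in>K. qf (M' k) (adj (W * U k * V k) *\<^sub>v x)) \<le> qf (W * N * adj W) x" .
  qed
qed

text \<open>A Hermitian resolution of the identity, \<open>\<Sum> Y\<^sub>k\<^sup>2 = 1\<close>.\<close>
definition resolution :: "nat \<Rightarrow> 'k set \<Rightarrow> ('k \<Rightarrow> complex mat) \<Rightarrow> bool" where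
  "resolution n K Y \<longleftrightarrow> finite K \<and> (\<forall>k\<in>K. Y k \<in> carrier_mat n n \<and> hermitian_mat (Y k)) \<and>
     (\<forall>x\<in>carrier_vec n. (\<Sum>k\<in>K. nsq (Y k *\<^sub>v x)) = nsq x)"

text \<open>For \<open>g t = \<psi> (sqrt t)\<close> this is \<open>\<psi>(|C|)\<close>.\<close>
definition gram_fun :: "(real \<Rightarrow> real) \<Rightarrow> complex mat \<Rightarrow> complex mat" where
  "gram_fun g C = mat_fun g (adj C * C)"

lemma gram_fun_adj:
  assumes C: "C \<in> carrier_mat n n" and g0: "g 0 = 0"
  shows "\<exists>U. unitary_mat n U \<and> gram_fun g (adj C) = U * gram_fun g C * adj U"
proof -
  obtain U where U: "unitary_mat n U" and eq: "C * adj C = U * (adj C * C) * adj U"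
    using gram_unitarily_equivalent[OF C] by blast
  show ?thesis
    using U mat_fun_isometry[where f = g, OF U gram_hermitian(1,2)[OF C] g0]
    unfolding gram_fun_def adj_adj eq by blast
qed

lemma gram_fun_carrier: "C \<in> carrier_mat n m \<Longrightarrow> gram_fun g C \<in> carrier_mat m m"
  unfolding gram_fun_def by (rule mat_fun_carrier(1)) (auto intro: gram_hermitian)

context
  fixes g :: "real \<Rightarrow> real"
  assumes mono: "mono_on {0..} g \<or> antimono_on {0..} g" and conv: "convex_on {0..} g" and g0: "g 0 = 0"
begin

lemma column_pinching:
  assumes C: "C \<in> carrier_mat n n" and Y: "resolution n K Y"
  shows "orbit_sum_le n K (\<lambda>k. gram_fun g (C * Y k)) (gram_fun g C)"
proof -
  have Yk: "Y k \<in> carrier_mat n n" "hermitian_mat (Y k)" if "k \<in> K" for k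
    using Y that by (auto simp: resolution_def)
  have le: "orbit_sum_le n K (\<lambda>k. mat_fun g (Y k * (adj C * C) * Y k)) (mat_fun g (adj C * C))"
    by (rule pinching_superadditive[where g = g, OF gram_hermitian[OF C] _ Yk _ mono conv g0])
      (use Y in \<open>auto simp: resolution_def\<close>)
  show ?thesis
    unfolding gram_fun_def
  proof (rule orbit_sum_le_cong[OF le])
    fix k assume k: "k \<in> K"
    have "adj (C * Y k) * (C * Y k) = Y k * (adj C * C) * Y k"
      using Yk[OF k] C by (simp add: hermitian_mat_def adj_mult mat_assoc)
    then show "mat_fun g (Y k * (adj C * C) * Y k) = mat_fun g (adj (C * Y k) * (C * Y k))" by simp
  qed
qed

text \<open>Row strips of \<open>C\<close> are the adjoints of column strips of \<open>C\<^sup>*\<close>, and passing to adjoints changes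
  \<open>gram_fun\<close> by a unitary conjugation only.\<close>
lemma row_pinching:
  assumes C: "C \<in> carrier_mat n n" and Y: "resolution n K Y"
  shows "orbit_sum_le n K (\<lambda>k. gram_fun g (Y k * C)) (gram_fun g C)"
proof -
  have Ca: "adj C \<in> carrier_mat n n" using C by simp
  have Yk: "Y k \<in> carrier_mat n n" "adj (Y k) = Y k" if "k \<in> K" for k
    using Y that by (auto simp: resolution_def hermitian_mat_def)
  obtain W where W: "unitary_mat n W" "gram_fun g C = W * gram_fun g (adj C) * adj W"
    using gram_fun_adj[where g = g, OF Ca g0] by auto
  show ?thesis
    unfolding W(2)
  proof (rule orbit_sum_le_unitary_conj[OF column_pinching[OF Ca Y] gram_fun_carrier[OF Ca] _ W(1)])
    fix k assume k: "k \<in> K"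
    show "gram_fun g (Y k * C) \<in> carrier_mat n n"
      by (rule gram_fun_carrier[of _ n]) (use C Yk(1)[OF k] in simp)
    have "adj C * Y k = adj (Y k * C)" using C Yk[OF k] by (simp add: adj_mult)
    then show "\<exists>V. unitary_mat n V \<and> gram_fun g (adj C * Y k) = V * gram_fun g (Y k * C) * adj V"
      using gram_fun_adj[of "Y k * C" n g] C Yk[OF k] g0 by simp
  qed
qed

lemma column_then_row_pinching:
  assumes A: "A \<in> carrier_mat n n" and K: "finite K"
    and cols: "resolution n (f ` K) Y" and rows: "\<And>S. S \<in> f ` K \<Longrightarrow> resolution n {k \<in> K. f k = S} Z"
  shows "orbit_sum_le n K (\<lambda>k. gram_fun g (Z k * A * Y (f k))) (gram_fun g A)"
proof (rule orbit_sum_le_trans[OF K column_pinching[OF A cols]])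
  fix S assume S: "S \<in> f ` K"
  have YS: "Y S \<in> carrier_mat n n" using cols S by (auto simp: resolution_def)
  then have AY: "A * Y S \<in> carrier_mat n n" using A by simp
  show "orbit_sum_le n {k \<in> K. f k = S} (\<lambda>k. gram_fun g (Z k * A * Y (f k))) (gram_fun g (A * Y S))"
  proof (rule orbit_sum_le_cong[OF row_pinching[OF AY rows[OF S]]])
    fix k assume k: "k \<in> {k \<in> K. f k = S}"
    then have "Z k \<in> carrier_mat n n" using rows[OF S] unfolding resolution_def by blast
    then show "gram_fun g (Z k * (A * Y S)) = gram_fun g (Z k * A * Y (f k))"
      using k assoc_mult_mat[OF _ A YS, of "Z k" n] by simp
  qed
qed

lemma row_then_column_pinching:
  assumes A: "A \<in> carrier_mat n n" and K: "finite K"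
    and rows: "resolution n (f ` K) Z" and cols: "\<And>S. S \<in> f ` K \<Longrightarrow> resolution n {k \<in> K. f k = S} Y"
  shows "orbit_sum_le n K (\<lambda>k. gram_fun g (Z (f k) * A * Y k)) (gram_fun g A)"
proof (rule orbit_sum_le_trans[OF K row_pinching[OF A rows]])
  fix S assume S: "S \<in> f ` K"
  have ZS: "Z S \<in> carrier_mat n n" using rows S by (auto simp: resolution_def)
  then have ZA: "Z S * A \<in> carrier_mat n n" using A by simp
  show "orbit_sum_le n {k \<in> K. f k = S} (\<lambda>k. gram_fun g (Z (f k) * A * Y k)) (gram_fun g (Z S * A))"
    by (rule orbit_sum_le_cong[OF column_pinching[OF ZA cols[OF S]]]) simp
qed

end

section \<open>Blocks as compressions by coordinate isometries\<close>

text \<open>The isometry whose columns are the unit vectors at the positions in \<open>I\<close>, in increasing order.\<close>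
definition incl_mat :: "nat \<Rightarrow> nat set \<Rightarrow> complex mat" where
  "incl_mat d I = mat d (card I) (\<lambda>(i, j). if i = pick I j then 1 else 0)"

lemma incl_mat_dim [simp]: "dim_row (incl_mat d I) = d" "dim_col (incl_mat d I) = card I"
  by (auto simp: incl_mat_def)

lemma bij_betw_pick:
  assumes "finite I"
  shows "bij_betw (pick I) {..<card I} I"
proof -
  have inj: "inj_on (pick I) {..<card I}"
    by (rule linorder_inj_onI) (use pick_mono_le[of _ I] in \<open>force+\<close>)
  have "pick I ` {..<card I} \<subseteq> I" using pick_in_set_le by auto
  moreover have "card (pick I ` {..<card I}) = card I" using card_image[OF inj] by simp
  ultimately have "pick I ` {..<card I} = I" using assms by (metis card_subset_eq)
  with inj show ?thesis by (simp add: bij_betw_def)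
qed

lemma adj_incl_mult:
  assumes I: "I \<subseteq> {..<d}" and M: "dim_row M = d" and ij: "i < card I" "j < dim_col M"
  shows "(adj (incl_mat d I) * M) $$ (i, j) = M $$ (pick I i, j)"
proof -
  have "pick I i < d" using pick_in_set_le[OF ij(1)] I by auto
  moreover have "(adj (incl_mat d I) * M) $$ (i, j) = (\<Sum>k<d. cnj (if k = pick I i then 1 else 0) * M $$ (k, j))"
    using M ij by (simp add: scalar_prod_def atLeast0LessThan incl_mat_def)
  moreover have "\<dots> = (\<Sum>k<d. if k = pick I i then M $$ (k, j) else 0)"
    by (rule sum.cong) auto
  ultimately show ?thesis by simp
qed

lemma mult_incl:
  assumes I: "I \<subseteq> {..<d}" and M: "dim_col M = d" and ij: "i < dim_row M" "j < card I"
  shows "(M * incl_mat d I) $$ (i, j) = M $$ (i, pick I j)"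
proof -
  have "pick I j < d" using pick_in_set_le[OF ij(2)] I by auto
  moreover have "(M * incl_mat d I) $$ (i, j) = (\<Sum>k<d. M $$ (i, k) * (if k = pick I j then 1 else 0))"
    using M ij by (simp add: scalar_prod_def atLeast0LessThan incl_mat_def)
  moreover have "\<dots> = (\<Sum>k<d. if k = pick I j then M $$ (i, k) else 0)"
    by (rule sum.cong) auto
  ultimately show ?thesis by simp
qed

lemma submatrix_eq_incl:
  assumes A: "A \<in> carrier_mat d d" and I: "I \<subseteq> {..<d}" and J: "J \<subseteq> {..<d}"
  shows "submatrix A I J = adj (incl_mat d I) * A * incl_mat d J"
proof -
  have *: "{i. i < d \<and> i \<in> S} = S" if "S \<subseteq> {..<d}" for S using that by auto
  show ?thesis
  proof (rule eq_matI)
    fix i j assume "i < dim_row (adj (incl_mat d I) * A * incl_mat d J)" "j < dim_col (adj (incl_mat d I) * A * incl_mat d J)"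
    then have ij: "i < card I" "j < card J" by auto
    have "pick J j < d" using pick_in_set_le[OF ij(2)] J by auto
    then have "(adj (incl_mat d I) * A * incl_mat d J) $$ (i, j) = A $$ (pick I i, pick J j)"
      using A ij by (subst mult_incl[OF J]) (auto simp: adj_incl_mult[OF I] simp del: index_mult_mat(1))
    then show "submatrix A I J $$ (i, j) = (adj (incl_mat d I) * A * incl_mat d J) $$ (i, j)"
      using A ij by (simp add: submatrix_def *[OF I] *[OF J])
  qed (use A in \<open>auto simp: dim_submatrix *[OF I] *[OF J]\<close>)
qed

lemma isometry_incl:
  assumes I: "I \<subseteq> {..<d}"
  shows "isometry_mat d (card I) (incl_mat d I)"
proof -
  have fin: "finite I" using I finite_subset by blast
  have "(adj (incl_mat d I) * incl_mat d I) $$ (i, j) = (if i = j then 1 else 0)" if ij: "i < card I" "j < card I" for i j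
  proof -
    have "pick I i < d" using pick_in_set_le[OF ij(1)] I by auto
    then have "(adj (incl_mat d I) * incl_mat d I) $$ (i, j) = (if pick I i = pick I j then 1 else 0)"
      using ij by (subst adj_incl_mult[OF I]) (auto simp: incl_mat_def)
    also have "pick I i = pick I j \<longleftrightarrow> i = j"
      using bij_betw_pick[OF fin] ij by (auto simp: bij_betw_def inj_on_def)
    finally show ?thesis .
  qed
  then have "adj (incl_mat d I) * incl_mat d I = 1\<^sub>m (card I)" by (intro eq_matI) auto
  moreover have "card I \<le> d" using card_mono[OF _ I] by simp
  ultimately show ?thesis by (auto simp: isometry_mat_def intro!: carrier_matI)
qed

definition coord_proj :: "nat \<Rightarrow> nat set \<Rightarrow> complex mat" where
  "coord_proj d I = incl_mat d I * adj (incl_mat d I)"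

lemma nsq_coord_proj:
  assumes I: "I \<subseteq> {..<d}" and x: "x \<in> carrier_vec d"
  shows "nsq (coord_proj d I *\<^sub>v x) = (\<Sum>i<d. if i \<in> I then (cmod (x $ i))\<^sup>2 else 0)"
proof -
  let ?P = "incl_mat d I"
  have fin: "finite I" using I finite_subset by blast
  have idx: "(adj ?P *\<^sub>v x) $ j = x $ pick I j" if "j < card I" for j
  proof -
    have "pick I j < d" using pick_in_set_le[OF that] I by auto
    moreover have "(adj ?P *\<^sub>v x) $ j = (\<Sum>k<d. cnj (if k = pick I j then 1 else 0) * x $ k)"
      using that x by (simp add: scalar_prod_def atLeast0LessThan incl_mat_def)
    moreover have "\<dots> = (\<Sum>k<d. if k = pick I j then x $ k else 0)"
      by (rule sum.cong) auto
    ultimately show ?thesis by simp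
  qed
  have "nsq (coord_proj d I *\<^sub>v x) = nsq (?P *\<^sub>v (adj ?P *\<^sub>v x))"
    using x by (simp add: coord_proj_def mat_vec_assoc)
  also have "\<dots> = nsq (adj ?P *\<^sub>v x)"
    by (rule nsq_isometry[OF isometry_incl[OF I]]) simp
  also have "\<dots> = (\<Sum>j<card I. (cmod (x $ pick I j))\<^sup>2)"
    by (subst nsq_sum[of _ "card I"]) (auto simp: idx simp del: index_mult_mat_vec)
  also have "\<dots> = (\<Sum>i\<in>I. (cmod (x $ i))\<^sup>2)"
    by (rule sum.reindex_bij_betw[OF bij_betw_pick[OF fin]])
  also have "\<dots> = (\<Sum>i<d. if i \<in> I then (cmod (x $ i))\<^sup>2 else 0)"
    using I by (simp add: sum.If_cases Int_absorb1)
  finally show ?thesis .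
qed

lemma resolution_coord_proj:
  assumes K: "finite K" and I: "\<And>k. k \<in> K \<Longrightarrow> I k \<subseteq> {..<d}" and ex1: "\<And>i. i < d \<Longrightarrow> \<exists>!k. k \<in> K \<and> i \<in> I k"
  shows "resolution d K (\<lambda>k. coord_proj d (I k))"
  unfolding resolution_def
proof (intro conjI ballI)
  fix k assume "k \<in> K"
  show "coord_proj d (I k) \<in> carrier_mat d d" by (simp add: coord_proj_def)
  show "hermitian_mat (coord_proj d (I k))" by (simp add: coord_proj_def hermitian_mat_def adj_mult)
next
  fix x :: "complex vec" assume x: "x \<in> carrier_vec d"
  have "(\<Sum>k\<in>K. nsq (coord_proj d (I k) *\<^sub>v x)) = (\<Sum>k\<in>K. \<Sum>i<d. if i \<in> I k then (cmod (x $ i))\<^sup>2 else 0)"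
    by (intro sum.cong refl nsq_coord_proj[OF I x])
  also have "\<dots> = (\<Sum>i<d. \<Sum>k\<in>K. if i \<in> I k then (cmod (x $ i))\<^sup>2 else 0)"
    by (rule sum.swap)
  also have "\<dots> = (\<Sum>i<d. (cmod (x $ i))\<^sup>2)"
  proof (rule sum.cong[OF refl])
    fix i assume "i \<in> {..<d}"
    then obtain k0 where k0: "k0 \<in> K" "\<And>k. k \<in> K \<Longrightarrow> i \<in> I k \<longleftrightarrow> k = k0" using ex1[of i] by blast
    have "(\<Sum>k\<in>K. if i \<in> I k then (cmod (x $ i))\<^sup>2 else 0) = (\<Sum>k\<in>K. if k = k0 then (cmod (x $ i))\<^sup>2 else 0)"
      by (intro sum.cong) (auto simp: k0)
    then show "(\<Sum>k\<in>K. if i \<in> I k then (cmod (x $ i))\<^sup>2 else 0) = (cmod (x $ i))\<^sup>2"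
      using K k0(1) by simp
  qed
  finally show "(\<Sum>k\<in>K. nsq (coord_proj d (I k) *\<^sub>v x)) = nsq x" by (simp add: nsq_sum[OF x])
qed (rule K)

text \<open>The column sets of a column compatible partitioning partition the columns; since blocks with the
  same column set can be separated only by their rows, the blocks over a given column set have row
  sets that partition the rows. Exchanging \<open>I\<close> and \<open>J\<close> gives the row compatible case.\<close>
lemma compatible_tiling:
  assumes cover: "(\<Union>k\<in>K. I k \<times> J k) = {..<d} \<times> {..<d}" and disj: "disjoint_family_on (\<lambda>k. I k \<times> J k) K"
    and ne: "\<And>k. k \<in> K \<Longrightarrow> I k \<noteq> {} \<and> J k \<noteq> {}"
    and comp: "\<And>k l. k \<in> K \<Longrightarrow> l \<in> K \<Longrightarrow> J k = J l \<or> J k \<inter> J l = {}" and i: "i < d"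
  shows "\<exists>!S. S \<in> J ` K \<and> i \<in> S"
    and "S \<in> J ` K \<Longrightarrow> \<exists>!k. k \<in> {k \<in> K. J k = S} \<and> i \<in> I k"
proof -
  have cov: "\<exists>k\<in>K. a \<in> I k \<and> b \<in> J k" if "a < d" "b < d" for a b
  proof -
    have "(a, b) \<in> (\<Union>k\<in>K. I k \<times> J k)" unfolding cover using that by simp
    then show ?thesis by auto
  qed
  show "\<exists>!S. S \<in> J ` K \<and> i \<in> S"
  proof -
    obtain k where "k \<in> K" "i \<in> J k" using cov[OF i i] by blast
    moreover have "S = T" if "S \<in> J ` K" "T \<in> J ` K" "i \<in> S" "i \<in> T" for S T
      using that comp by blast
    ultimately show ?thesis by blast
  qed
  show "\<exists>!k. k \<in> {k \<in> K. J k = S} \<and> i \<in> I k" if S: "S \<in> J ` K"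
  proof -
    obtain l j where l: "l \<in> K" "J l = S" "j \<in> S" using S ne by blast
    obtain a where "a \<in> I l" using ne[OF l(1)] by blast
    then have "(a, j) \<in> (\<Union>k\<in>K. I k \<times> J k)" using l by blast
    then have j: "j < d" unfolding cover by simp
    obtain k where k: "k \<in> K" "i \<in> I k" "j \<in> J k" using cov[OF i j] by blast
    have "J k = S" using comp[OF k(1) l(1)] k l by blast
    moreover have "k' = k" if "k' \<in> K" "J k' = S" "i \<in> I k'" for k'
    proof (rule ccontr)
      assume "k' \<noteq> k"
      then have "(I k' \<times> J k') \<inter> (I k \<times> J k) = {}"
        using disj that(1) k(1) unfolding disjoint_family_on_def by blast
      then show False using that k l by blast
    qed
    ultimately show ?thesis using k by blast
  qed
qed

text \<open>The padded block is \<open>P B Q\<^sup>*\<close> with coordinate isometries \<open>P\<close>, \<open>Q\<close>; in its Gram matrix \<open>P\<close>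
  cancels, and the isometry \<open>Q\<close> passes through the functional calculus.\<close>
lemma block_gram_fun:
  assumes A: "A \<in> carrier_mat d d" and I: "I \<subseteq> {..<d}" and J: "J \<subseteq> {..<d}" and g0: "g 0 = 0"
  shows "gram_fun g (coord_proj d I * A * coord_proj d J) =
    incl_mat d J * gram_fun g (submatrix A I J) * adj (incl_mat d J)"
proof -
  let ?P = "incl_mat d I" and ?Q = "incl_mat d J" and ?B = "submatrix A I J"
  note P = isometry_incl[OF I] and Q = isometry_incl[OF J]
  have B: "?B = adj ?P * A * ?Q" by (rule submatrix_eq_incl[OF A I J])
  have Bc: "?B \<in> carrier_mat (card I) (card J)" unfolding B using A by simp
  have "coord_proj d I * A * coord_proj d J = ?P * ?B * adj ?Q"
    unfolding B coord_proj_def using A by (simp add: mat_assoc)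
  then have "adj (coord_proj d I * A * coord_proj d J) * (coord_proj d I * A * coord_proj d J) =
      ?Q * (adj ?B * ?B) * adj ?Q"
    using Bc by (simp add: adj_mult mat_assoc isometry_cancel[OF P])
  then show ?thesis
    unfolding gram_fun_def using mat_fun_isometry[where f = g, OF Q gram_hermitian(1,2)[OF Bc] g0] by simp
qed

section \<open>Sums in the Loewner order and the partitioned matrix\<close>

lemma finsum_qf:
  assumes "finite K" "\<And>k. k \<in> K \<Longrightarrow> M k \<in> carrier_mat n n" "\<And>k. k \<in> K \<Longrightarrow> hermitian_mat (M k)"
  shows "finsum (module_mat TYPE(complex) n n) M K \<in> carrier_mat n n \<and>
    hermitian_mat (finsum (module_mat TYPE(complex) n n) M K) \<and>
    (\<forall>x\<in>carrier_vec n. qf (finsum (module_mat TYPE(complex) n n) M K) x = (\<Sum>k\<in>K. qf (M k) x))"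
  using assms
proof (induction K rule: finite_induct)
  interpret abelian_group "module_mat TYPE(complex) n n" by (rule abelian_group_mat)
  case empty
  have "adj (0\<^sub>m n n) = 0\<^sub>m n n" by (rule eq_matI) auto
  moreover have zero_diag: "mat_diag n (\<lambda>_. 0) = (0\<^sub>m n n :: complex mat)" by (rule eq_matI) (auto simp: mat_diag_def)
  ultimately show ?case
    using finsum_empty[of M] qf_real_diag[of _ n "\<lambda>_. 0"] zero_diag
    by (simp add: module_mat_simps hermitian_mat_def)
next
  interpret abelian_group "module_mat TYPE(complex) n n" by (rule abelian_group_mat)
  case (insert a F)
  let ?S = "finsum (module_mat TYPE(complex) n n) M F"
  have eq: "finsum (module_mat TYPE(complex) n n) M (insert a F) = M a + ?S"
    using finsum_insert[of F a M] insert by (auto simp: module_mat_simps)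
  have S: "?S \<in> carrier_mat n n" "adj ?S = ?S" and Ma: "M a \<in> carrier_mat n n" "adj (M a) = M a"
    using insert by (auto simp: hermitian_mat_def)
  have "adj (M a + ?S) = adj (M a) + adj ?S" using S(1) Ma(1) by (intro eq_matI) auto
  moreover have "qf (M a + ?S) x = qf (M a) x + qf ?S x" if x: "x \<in> carrier_vec n" for x
  proof -
    have "(M a + ?S) *\<^sub>v x = M a *\<^sub>v x + ?S *\<^sub>v x"
      by (rule add_mult_distrib_mat_vec[OF Ma(1) S(1) x])
    moreover have "(M a *\<^sub>v x + ?S *\<^sub>v x) \<bullet>c x = (M a *\<^sub>v x) \<bullet>c x + (?S *\<^sub>v x) \<bullet>c x"
      using S(1) Ma(1) x by (intro add_scalar_prod_distrib[of _ n]) auto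
    ultimately show ?thesis by (simp add: qf_def)
  qed
  ultimately show ?case
    using insert S Ma unfolding eq by (auto simp: hermitian_mat_def)
qed

lemma mat_fun_mat_abs:
  assumes "S \<in> carrier_mat n m"
  shows "mat_fun \<psi> (mat_abs S) = gram_fun (\<lambda>t. \<psi> (sqrt t)) S"
  unfolding mat_abs_def gram_fun_def by (rule mat_fun_comp[OF gram_hermitian(1,2)[OF assms]])

theorem theorem5p1:
  fixes A :: "complex mat"
    and d r :: nat
    and n m :: "nat \<Rightarrow> nat"
    and I J :: "nat \<Rightarrow> nat set"
    and \<psi> :: "real \<Rightarrow> real"
  assumes "A \<in> carrier_mat d d"
    and "block_partition d r I J"
    and "\<And>k. k \<in> {1..r} \<Longrightarrow> submatrix A (I k) (J k) \<in> carrier_mat (n k) (m k)"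
    and "compatible r I \<or> compatible r J"
    and "mono_on {0..} \<psi> \<or> antimono_on {0..} \<psi>"
    and "convex_on {0..} (\<lambda>t. \<psi> (sqrt t))"
    and "\<psi> 0 = 0"
  shows "\<exists>V. (\<forall>k \<in> {1..r}. isometry_mat d (m k) (V k)) \<and>
    loewner_le
      (finsum (module_mat TYPE(complex) d d)
        (\<lambda>k. V k * mat_fun \<psi> (mat_abs (submatrix A (I k) (J k))) * mat_adjoint (V k)) {1..r})
      (mat_fun \<psi> (mat_abs A))"
proof -
  note A = assms(1)
  define g where "g = (\<lambda>t. \<psi> (sqrt t))"
  have g0: "g 0 = 0" using assms(7) by (simp add: g_def)
  have conv: "convex_on {0..} g" using assms(6) by (simp add: g_def)
  have mono: "mono_on {0..} g \<or> antimono_on {0..} g"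
    using assms(5) unfolding g_def monotone_on_def by auto
  let ?K = "{1..r}"
  have IJ: "I k \<subseteq> {..<d}" "J k \<subseteq> {..<d}" "I k \<noteq> {} \<and> J k \<noteq> {}" if "k \<in> ?K" for k
  proof -
    have "nonempty_interval d (I k)" "nonempty_interval d (J k)"
      using assms(2) that by (simp_all add: block_partition_def)
    then show "I k \<subseteq> {..<d}" "J k \<subseteq> {..<d}" "I k \<noteq> {} \<and> J k \<noteq> {}"
      by (auto simp: nonempty_interval_def)
  qed
  have disj: "disjoint_family_on (\<lambda>k. I k \<times> J k) ?K" and cover: "(\<Union>k\<in>?K. I k \<times> J k) = {..<d} \<times> {..<d}"
    using assms(2) by (simp_all add: block_partition_def)
  have disj': "disjoint_family_on (\<lambda>k. J k \<times> I k) ?K"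
    using disj unfolding disjoint_family_on_def by (simp add: Times_Int_Times Int_commute) blast
  have cover': "(\<Union>k\<in>?K. J k \<times> I k) = {..<d} \<times> {..<d}"
  proof -
    have "(\<Union>k\<in>?K. J k \<times> I k) = prod.swap ` (\<Union>k\<in>?K. I k \<times> J k)"
      by (simp only: image_UN product_swap)
    then show ?thesis unfolding cover by (simp add: product_swap)
  qed
  have blocks: "orbit_sum_le d ?K (\<lambda>k. gram_fun g (coord_proj d (I k) * A * coord_proj d (J k))) (gram_fun g A)"
    using assms(4)
  proof
    assume "compatible r J"
    then have comp: "\<And>k l. k \<in> ?K \<Longrightarrow> l \<in> ?K \<Longrightarrow> J k = J l \<or> J k \<inter> J l = {}" by (simp add: compatible_def)
    note tiling = compatible_tiling[OF cover disj IJ(3) comp]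
    show ?thesis
    proof (rule column_then_row_pinching[where g = g and f = J and Y = "coord_proj d" and Z = "\<lambda>k. coord_proj d (I k)", OF mono conv g0 A])
      show "resolution d (J ` ?K) (coord_proj d)"
      proof (rule resolution_coord_proj[where I = "\<lambda>S. S"])
        show "S \<subseteq> {..<d}" if "S \<in> J ` ?K" for S
          using that IJ(2) by (elim imageE) simp
      qed (use tiling(1) in simp_all)
      show "resolution d {k \<in> ?K. J k = S} (\<lambda>k. coord_proj d (I k))" if "S \<in> J ` ?K" for S
        by (rule resolution_coord_proj) (use IJ tiling(2) that in auto)
    qed simp
  next
    assume "compatible r I"
    then have comp: "\<And>k l. k \<in> ?K \<Longrightarrow> l \<in> ?K \<Longrightarrow> I k = I l \<or> I k \<inter> I l = {}" by (simp add: compatible_def)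
    have ne: "\<And>k. k \<in> ?K \<Longrightarrow> J k \<noteq> {} \<and> I k \<noteq> {}" using IJ(3) by blast
    note tiling = compatible_tiling[OF cover' disj' ne comp]
    show ?thesis
    proof (rule row_then_column_pinching[where g = g and f = I and Z = "coord_proj d" and Y = "\<lambda>k. coord_proj d (J k)", OF mono conv g0 A])
      show "resolution d (I ` ?K) (coord_proj d)"
      proof (rule resolution_coord_proj[where I = "\<lambda>S. S"])
        show "S \<subseteq> {..<d}" if "S \<in> I ` ?K" for S
          using that IJ(1) by (elim imageE) simp
      qed (use tiling(1) in simp_all)
      show "resolution d {k \<in> ?K. I k = S} (\<lambda>k. coord_proj d (J k))" if "S \<in> I ` ?K" for S
        by (rule resolution_coord_proj) (use IJ tiling(2) that in auto)
    qed simp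
  qed
  then obtain U where U: "\<And>k. k \<in> ?K \<Longrightarrow> unitary_mat d (U k)"
    and Ule: "\<And>x. x \<in> carrier_vec d \<Longrightarrow>
      (\<Sum>k\<in>?K. qf (gram_fun g (coord_proj d (I k) * A * coord_proj d (J k))) (adj (U k) *\<^sub>v x)) \<le> qf (gram_fun g A) x"
    unfolding orbit_sum_le_def by blast
  define V where "V = (\<lambda>k. U k * incl_mat d (J k))"
  define B where "B = (\<lambda>k. submatrix A (I k) (J k))"
  have m: "m k = card (J k)" if "k \<in> ?K" for k
  proof -
    have "m k = card {j. j < d \<and> j \<in> J k}"
      using carrier_matD(2)[OF assms(3)[OF that]] carrier_matD(2)[OF A] by (simp add: dim_submatrix)
    also have "{j. j < d \<and> j \<in> J k} = J k" using IJ(2)[OF that] by blast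
    finally show ?thesis .
  qed
  have V: "isometry_mat d (m k) (V k)" if "k \<in> ?K" for k
    unfolding V_def m[OF that] by (rule isometry_mult[OF U[OF that] isometry_incl[OF IJ(2)[OF that]]])
  have GB: "gram_fun g (B k) \<in> carrier_mat (m k) (m k)" "hermitian_mat (gram_fun g (B k))" if "k \<in> ?K" for k
    unfolding gram_fun_def B_def
    by (rule mat_fun_carrier[OF gram_hermitian(1,2)[OF assms(3)[OF that]]])+
  have GA: "gram_fun g A \<in> carrier_mat d d" "hermitian_mat (gram_fun g A)"
    unfolding gram_fun_def by (rule mat_fun_carrier[OF gram_hermitian(1,2)[OF A]])+
  define T where "T = (\<lambda>k. V k * gram_fun g (B k) * adj (V k))"
  have T: "T k \<in> carrier_mat d d" "hermitian_mat (T k)" if "k \<in> ?K" for k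
    using isometryD(1)[OF V[OF that]] hermitian_conj[OF GB[OF that]] by (simp_all add: T_def)
  have qfT: "qf (T k) x = qf (gram_fun g (coord_proj d (I k) * A * coord_proj d (J k))) (adj (U k) *\<^sub>v x)"
    if k: "k \<in> ?K" and x: "x \<in> carrier_vec d" for k x
  proof -
    let ?P = "incl_mat d (J k)"
    note Uk = isometryD(1)[OF U[OF k]] and P = isometryD(1)[OF isometry_incl[OF IJ(2)[OF k]]]
    have "T k = U k * (?P * gram_fun g (B k) * adj ?P) * adj (U k)"
      using Uk P GB[OF k] m[OF k] by (simp add: T_def V_def adj_mult mat_assoc)
    also have "?P * gram_fun g (B k) * adj ?P = gram_fun g (coord_proj d (I k) * A * coord_proj d (J k))"
      unfolding B_def by (rule block_gram_fun[where g = g, OF A IJ(1,2)[OF k] g0, symmetric])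
    finally have T_eq: "T k = U k * gram_fun g (coord_proj d (I k) * A * coord_proj d (J k)) * adj (U k)" .
    show ?thesis
      unfolding T_eq by (rule qf_conj[OF gram_fun_carrier[where n = d] Uk x]) (simp add: coord_proj_def)
  qed
  define F where "F = finsum (module_mat TYPE(complex) d d) T ?K"
  have F: "F \<in> carrier_mat d d" "hermitian_mat F" "\<And>x. x \<in> carrier_vec d \<Longrightarrow> qf F x = (\<Sum>k\<in>?K. qf (T k) x)"
    unfolding F_def using finsum_qf[of ?K T d] T by simp_all
  have "loewner_le F (gram_fun g A)"
    unfolding loewner_le_def
  proof (intro exI conjI ballI)
    fix x :: "complex vec" assume x: "x \<in> carrier_vec d"
    have "qf F x \<le> qf (gram_fun g A) x"
      unfolding F(3)[OF x] using Ule[OF x] by (simp add: qfT x)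
    moreover have "(gram_fun g A - F) *\<^sub>v x = gram_fun g A *\<^sub>v x - F *\<^sub>v x"
      by (rule minus_mult_distrib_mat_vec[OF GA(1) F(1) x])
    moreover have "(gram_fun g A *\<^sub>v x - F *\<^sub>v x) \<bullet>c x = (gram_fun g A *\<^sub>v x) \<bullet>c x - (F *\<^sub>v x) \<bullet>c x"
      using GA(1) F(1) x by (intro minus_scalar_prod_distrib[of _ d]) auto
    ultimately show "0 \<le> Re (((gram_fun g A - F) *\<^sub>v x) \<bullet>c x)" by (simp add: qf_def)
  qed (use F GA in auto)
  also have "F = finsum (module_mat TYPE(complex) d d)
      (\<lambda>k. V k * mat_fun \<psi> (mat_abs (submatrix A (I k) (J k))) * adj (V k)) ?K"
  proof -
    interpret abelian_group "module_mat TYPE(complex) d d" by (rule abelian_group_mat)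
    have T_abs: "V k * mat_fun \<psi> (mat_abs (submatrix A (I k) (J k))) * adj (V k) = T k" if "k \<in> ?K" for k
      unfolding T_def B_def g_def by (simp only: mat_fun_mat_abs[OF assms(3)[OF that]])
    show ?thesis unfolding F_def
    proof (rule finsum_cong'[OF refl])
      show "(\<lambda>k. V k * mat_fun \<psi> (mat_abs (submatrix A (I k) (J k))) * adj (V k))
          \<in> ?K \<rightarrow> carrier (module_mat TYPE(complex) d d)"
        by (rule Pi_I) (simp only: T_abs T(1) module_mat_simps)
    qed (simp only: T_abs)
  qed
  finally show ?thesis
    using V unfolding g_def mat_fun_mat_abs[OF A, symmetric] by blast
qed

end
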